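(* Let $\varphi\in\mathcal{A}=\mathbf{F}[x,y,z]$ be a weight homogeneous polynomial with an isolated singularity, and let $\{\cdot,\cdot\}_\varphi$ be the Poisson bracket on $\mathcal{A}$ determined by $$\{x,y\}_\varphi=\frac{\partial\varphi}{\partial z},\quad\{y,z\}_\varphi=\frac{\partial\varphi}{\partial x},\quad\{z,x\}_\varphi=\frac{\partial\varphi}{\partial y}.$$ (a) There exist a family $(\vartheta_k)_{k\in\mathcal{K}}$ of Poisson $2$-cocycles of $(\mathcal{A},\{\cdot,\cdot\}_\varphi)$, whose cohomology classes form an $\mathbf{F}$-basis of $H^2(\mathcal{A},\{\cdot,\cdot\}_\varphi)$, and, for each $\mathbf{a}=(a_n^k)\in\mathcal{S}$, a sequence $(\Psi_n^{\mathbf{a}})_{n\in\mathbf{N}^*}$ of skew-symmetric biderivations of $\mathcal{A}$, such that for all $\mathbf{a}\in\mathcal{S}$: $\Psi_1^{\mathbf{a}}=0$; for all $n\in\mathbf{N}^*$, $\Psi_n^{\mathbf{a}}$ depends only on the $a_m^k$ with $k\in\mathcal{K}$ and $1\le m\le n-1$; and $$\pi_*^{\mathbf{a}}:=\{\cdot,\cdot\}_\varphi+\sum_{n\in\mathbf{N}^*}\Big(\Psi_n^{\mathbf{a}}+\sum_{k\in\mathcal{K}}a_n^k\,\vartheta_k\Big)\nu^n$$ is a formal deformation of $\{\cdot,\cdot\}_\varphi$. Here $\mathcal{S}$ is the set of all families $\mathbf{a}=(a_n^k\in\mathbf{F})_{k\in\mathcal{K},\,n\in\mathbf{N}^*}$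 such that, for every $n_0\in\mathbf{N}^*$, $(a_{n_0}^k)_{k\in\mathcal{K}}$ has finite support. (b) $H^1(\mathcal{A},\{\cdot,\cdot\}_\varphi)=\{0\}$, unless the weighted degree of $\varphi$ equals the sum of the weights of the variables $x,y,z$.
   Context: $\mathbf{F}$ is a field of characteristic zero and $\mathbf{N}^*=\{1,2,3,\dots\}$. A polynomial $\varphi\in\mathbf{F}[x,y,z]$ is weight homogeneous of weighted degree $\varpi(\varphi)\in\mathbf{N}$ if there are (fixed) positive integers $\varpi_1,\varpi_2,\varpi_3$ without common divisor (the weights of $x,y,z$) with $\varpi_1x\frac{\partial\varphi}{\partial x}+\varpi_2y\frac{\partial\varphi}{\partial y}+\varpi_3z\frac{\partial\varphi}{\partial z}=\varpi(\varphi)\varphi$. It has an isolated singularity (at the origin) if $\mathcal{A}_{sing}(\varphi)=\mathbf{F}[x,y,z]/\langle\frac{\partial\varphi}{\partial x},\frac{\partial\varphi}{\partial y},\frac{\partial\varphi}{\partial z}\rangle$ is finite-dimensional over $\mathbf{F}$, of dimension $\mu\ge1$. For a commutative $\mathbf{F}$-algebra $\mathcal{A}$, $\mathfrak{X}^0(\mathcal{A})=\mathcal{A}$ and $\mathfrak{X}^k(\mathcal{A})$ ($k\ge1$) is the space of skew-symmetric $k$-linear maps $\mathcal{A}^k\to\mathcal{A}$ that are derivations in each argument. A Poisson structure is an element of $\mathfrak{X}^2(\mathcal{A})$ satisfying the Jacobi identity. For a Poisson structure $\pi_0$, the Poisson coboundary operator is $\delta^k_{\pi_0}:\mathfrak{X}^k(\mathcal{A})\to\mathfrak{X}^{k+1}(\mathcal{A})$,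 $\delta^k_{\pi_0}(P)=-[P,\pi_0]_S$, with $[\cdot,\cdot]_S$ the Schouten bracket (the graded Lie bracket on multiderivations extending the commutator of derivations, a graded biderivation for the wedge product); $k$-cocycles are elements of $\ker\delta^k_{\pi_0}$ and $H^k(\mathcal{A},\pi_0)=\ker\delta^k_{\pi_0}/\operatorname{Im}\delta^{k-1}_{\pi_0}$ for $k\ge 1$. Explicitly, 1-cocycles are the derivations $V$ of $\mathcal{A}$ with $V(\pi_0[F,G])=\pi_0[V(F),G]+\pi_0[F,V(G)]$, and 1-coboundaries are the derivations $\pi_0[H,\cdot]$, $H\in\mathcal{A}$. A formal deformation of $\pi_0$ is a map $\pi_*=\pi_0+\pi_1\nu+\pi_2\nu^2+\cdots:\mathcal{A}[[\nu]]\times\mathcal{A}[[\nu]]\to\mathcal{A}[[\nu]]$, with all $\pi_i\in\mathfrak{X}^2(\mathcal{A})$ extended $\mathbf{F}[[\nu]]$-bilinearly, which satisfies the Jacobi identity. *)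

theory Defs
  imports
    "HOL-Library.Poly_Mapping"
    "HOL-Library.Numeral_Type"
    "HOL-Library.Function_Algebras"
    "HOL-Library.Set_Algebras"
    "HOL-Computational_Algebra.Formal_Power_Series"
begin

section \<open>The polynomial algebra in three variables\<close>

text \<open>
  Monomials are finitely supported exponent functions on the three-element type \<open>3\<close>, whose
  elements \<open>0\<close>, \<open>1\<close>, \<open>2\<close> stand for the variables $x$, $y$, $z$; the product on
  \<open>\<Rightarrow>\<^sub>0\<close> is convolution.
\<close>

type_synonym 'f poly3 = "(3 \<Rightarrow>\<^sub>0 nat) \<Rightarrow>\<^sub>0 'f"

definition Var :: "3 \<Rightarrow> 'f::field_char_0 poly3" where
  "Var i = Poly_Mapping.single (Poly_Mapping.single i 1) 1"

definition smult3 :: "'f::field_char_0 \<Rightarrow> 'f poly3 \<Rightarrow> 'f poly3" where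
  "smult3 c p = Poly_Mapping.single 0 c * p"

text \<open>
  If \<open>i\<close> does not occur in the monomial \<open>m\<close>, the truncated difference is
  harmless, because the coefficient is then zero.
\<close>

definition pdiff :: "3 \<Rightarrow> 'f::field_char_0 poly3 \<Rightarrow> 'f poly3" where
  "pdiff i p = (\<Sum>m\<in>Poly_Mapping.keys p.
     Poly_Mapping.single (m - Poly_Mapping.single i 1)
       (of_nat (Poly_Mapping.lookup m i) * Poly_Mapping.lookup p m))"

section \<open>Quotients of vector spaces\<close>

text \<open>
  For subspaces \<open>W \<subseteq> V\<close>, the elements of the quotient space are the cosets \<open>v +o W\<close>
  with \<open>v \<in> V\<close>. The vector operations are induced by representatives, so the linear combination
  of the classes of the vectors \<open>\<theta> k\<close> with coefficients \<open>c k\<close> is the coset of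
  \<open>lincomb scale K c \<theta>\<close>. Coefficient families are meant to have finite support on \<open>K\<close>;
  their values off \<open>K\<close> are irrelevant.
\<close>

definition lincomb ::
  "('f::zero \<Rightarrow> 'v \<Rightarrow> 'v::comm_monoid_add) \<Rightarrow> 'k set \<Rightarrow> ('k \<Rightarrow> 'f) \<Rightarrow> ('k \<Rightarrow> 'v) \<Rightarrow> 'v" where
  "lincomb scale K c \<theta> = (\<Sum>k | k \<in> K \<and> c k \<noteq> 0. scale (c k) (\<theta> k))"

definition classes :: "'v::ab_group_add set \<Rightarrow> 'v set \<Rightarrow> 'v set set" where
  "classes V W = (\<lambda>v. v +o W) ` V"

definition classes_basis ::
  "('f::zero \<Rightarrow> 'v \<Rightarrow> 'v) \<Rightarrow> 'v::ab_group_add set \<Rightarrow> 'v set \<Rightarrow> 'k set \<Rightarrow> ('k \<Rightarrow> 'v) \<Rightarrow> bool" where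
  "classes_basis scale V W K \<theta> \<longleftrightarrow>
     (\<forall>k\<in>K. \<theta> k \<in> V) \<and>
     (\<forall>c. finite {k \<in> K. c k \<noteq> 0} \<longrightarrow> lincomb scale K c \<theta> +o W = W \<longrightarrow> (\<forall>k\<in>K. c k = 0)) \<and>
     (\<forall>C\<in>classes V W. \<exists>c. finite {k \<in> K. c k \<noteq> 0} \<and> C = lincomb scale K c \<theta> +o W)"

definition quotient_has_dim ::
  "('f::zero \<Rightarrow> 'v \<Rightarrow> 'v) \<Rightarrow> 'v::ab_group_add set \<Rightarrow> 'v set \<Rightarrow> nat \<Rightarrow> bool" where
  "quotient_has_dim scale V W n \<longleftrightarrow> (\<exists>b. classes_basis scale V W {..<n} b)"

section \<open>Weight homogeneous polynomials and isolated singularities\<close>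

definition weight_homogeneous :: "(3 \<Rightarrow> nat) \<Rightarrow> nat \<Rightarrow> 'f::field_char_0 poly3 \<Rightarrow> bool" where
  "weight_homogeneous w d \<phi> \<longleftrightarrow>
     (\<forall>i. 0 < w i) \<and> Gcd (w ` UNIV) = 1 \<and>
     of_nat (w 0) * Var 0 * pdiff 0 \<phi> + of_nat (w 1) * Var 1 * pdiff 1 \<phi>
       + of_nat (w 2) * Var 2 * pdiff 2 \<phi> = of_nat d * \<phi>"

definition jacobian_ideal :: "'f::field_char_0 poly3 \<Rightarrow> 'f poly3 set" where
  "jacobian_ideal \<phi> = {a * pdiff 0 \<phi> + b * pdiff 1 \<phi> + c * pdiff 2 \<phi> | a b c. True}"

definition isolated_singularity :: "'f::field_char_0 poly3 \<Rightarrow> bool" where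
  "isolated_singularity \<phi> \<longleftrightarrow> (\<exists>\<mu>\<ge>1. quotient_has_dim smult3 UNIV (jacobian_ideal \<phi>) \<mu>)"

section \<open>Multiderivations and the Schouten bracket\<close>

text \<open>
  A \<open>k\<close>-derivation is a function on argument lists which vanishes on lists of length other
  than \<open>k\<close>, so that equality of multiderivations is equality of functions. Sums are pointwise.
  For \<open>k = 0\<close> the only information is the value at the empty list, an element of the algebra.
\<close>

type_synonym 'f cochain = "'f poly3 list \<Rightarrow> 'f poly3"

definition cscale :: "'f::field_char_0 \<Rightarrow> 'f cochain \<Rightarrow> 'f cochain" where
  "cscale c P = (\<lambda>xs. smult3 c (P xs))"

definition multiderivations :: "nat \<Rightarrow> 'f::field_char_0 cochain set" where
  "multiderivations k = {P.
     (\<forall>xs. length xs \<noteq> k \<longrightarrow> P xs = 0) \<and>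
     (\<forall>xs ys f g. P (xs @ (f + g) # ys) = P (xs @ f # ys) + P (xs @ g # ys)) \<and>
     (\<forall>xs ys c f. P (xs @ smult3 c f # ys) = smult3 c (P (xs @ f # ys))) \<and>
     (\<forall>xs ys f g. P (xs @ (f * g) # ys) = f * P (xs @ g # ys) + g * P (xs @ f # ys)) \<and>
     (\<forall>xs ys f g. P (xs @ f # g # ys) = - P (xs @ g # f # ys))}"

text \<open>
  An \<open>(q, n - q)\<close>-shuffle is given by the set \<open>S\<close> of the \<open>q\<close> positions it moves to the
  front; its sign is the parity of the number of inversions.
\<close>

definition shuffle_sign :: "nat \<Rightarrow> nat set \<Rightarrow> 'f::field_char_0 poly3" where
  "shuffle_sign n S = (- 1) ^ card {(i, j). i \<in> S \<and> j \<in> {..<n} - S \<and> j < i}"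

definition insertion :: "nat \<Rightarrow> 'f::field_char_0 cochain \<Rightarrow> 'f cochain \<Rightarrow> 'f cochain" where
  "insertion q P Q xs = (\<Sum>S | S \<subseteq> {..<length xs} \<and> card S = q.
     shuffle_sign (length xs) S * P (Q (nths xs S) # nths xs (- S)))"

text \<open>
  The standard formula for the Schouten bracket of a \<open>p\<close>-derivation and a \<open>q\<close>-derivation:
  $[P,Q]_S = P \circ Q - (-1)^{(p-1)(q-1)} Q \circ P$, where $P \circ Q$ is the shuffle sum of
  the insertions of $Q$ into the first argument of $P$. The exponent is written
  \<open>(p + 1) * (q + 1)\<close>, of the same parity, to avoid truncated subtraction.
\<close>

definition schouten ::
  "nat \<Rightarrow> nat \<Rightarrow> 'f::field_char_0 cochain \<Rightarrow> 'f cochain \<Rightarrow> 'f cochain" where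
  "schouten p q P Q xs =
     (if length xs + 1 = p + q
      then insertion q P Q xs - (- 1) ^ ((p + 1) * (q + 1)) * insertion p Q P xs else 0)"

section \<open>Poisson structures and their cohomology\<close>

definition poisson_structure :: "'f::field_char_0 cochain \<Rightarrow> bool" where
  "poisson_structure \<pi> \<longleftrightarrow> \<pi> \<in> multiderivations 2 \<and>
     (\<forall>f g h. \<pi> [\<pi> [f, g], h] + \<pi> [\<pi> [g, h], f] + \<pi> [\<pi> [h, f], g] = 0)"

definition coboundary_op :: "'f::field_char_0 cochain \<Rightarrow> nat \<Rightarrow> 'f cochain \<Rightarrow> 'f cochain" where
  "coboundary_op \<pi> k P = - schouten k 2 P \<pi>"

definition cocycles :: "'f::field_char_0 cochain \<Rightarrow> nat \<Rightarrow> 'f cochain set" where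
  "cocycles \<pi> k = {P \<in> multiderivations k. coboundary_op \<pi> k P = 0}"

definition coboundaries :: "'f::field_char_0 cochain \<Rightarrow> nat \<Rightarrow> 'f cochain set" where
  "coboundaries \<pi> k =
     (if k = 0 then {0} else coboundary_op \<pi> (k - 1) ` multiderivations (k - 1))"

definition poisson_cohomology :: "'f::field_char_0 cochain \<Rightarrow> nat \<Rightarrow> 'f cochain set set" where
  "poisson_cohomology \<pi> k = classes (cocycles \<pi> k) (coboundaries \<pi> k)"

definition cohomology_basis ::
  "'f::field_char_0 cochain \<Rightarrow> nat \<Rightarrow> 'k set \<Rightarrow> ('k \<Rightarrow> 'f cochain) \<Rightarrow> bool" where
  "cohomology_basis \<pi> k K \<theta> \<longleftrightarrow> classes_basis cscale (cocycles \<pi> k) (coboundaries \<pi> k) K \<theta>"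

section \<open>Formal deformations\<close>

text \<open>
  The $\mathbf{F}[[\nu]]$-bilinear extension is the one compatible with infinite sums in \<open>\<nu>\<close>: the
  coefficient of $\nu^n$ in $\pi_*[F,G]$ is $\sum_{i+j+l=n}\pi_i[F_j,G_l]$.
\<close>

definition extend_bracket ::
  "(nat \<Rightarrow> 'f::field_char_0 cochain) \<Rightarrow> 'f poly3 fps \<Rightarrow> 'f poly3 fps \<Rightarrow> 'f poly3 fps" where
  "extend_bracket \<pi> F G = Abs_fps (\<lambda>n. \<Sum>i\<le>n. \<Sum>j\<le>n - i.
     \<pi> i [fps_nth F j, fps_nth G (n - i - j)])"

definition formal_deformation ::
  "'f::field_char_0 cochain \<Rightarrow> (nat \<Rightarrow> 'f cochain) \<Rightarrow> bool" where
  "formal_deformation \<pi>\<^sub>0 \<pi> \<longleftrightarrow>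
     \<pi> 0 = \<pi>\<^sub>0 \<and> (\<forall>n. \<pi> n \<in> multiderivations 2) \<and>
     (\<forall>F G H. extend_bracket \<pi> (extend_bracket \<pi> F G) H
            + extend_bracket \<pi> (extend_bracket \<pi> G H) F
            + extend_bracket \<pi> (extend_bracket \<pi> H F) G = 0)"

text \<open>
  The parameter families $(a_n^k)$ with $k \in K$, $n \ge 1$, written \<open>a n k\<close>. Values at
  \<open>n = 0\<close> or \<open>k \<notin> K\<close> carry no meaning.
\<close>

definition param_families :: "'k set \<Rightarrow> (nat \<Rightarrow> 'k \<Rightarrow> 'f::field_char_0) set" where
  "param_families K = {a. \<forall>n\<ge>1. finite {k \<in> K. a n k \<noteq> 0}}"

section \<open>Consistency checks\<close>

text \<open>
  In low degrees the coboundary operator is the expected one (\<open>coboundary_op_0\<close>,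
  \<open>coboundary_op_1\<close>), and for every \<open>\<phi>\<close> there is exactly one Poisson structure
  with the prescribed values on pairs of variables (\<open>ex1_poisson_bracket\<close>).
\<close>

lemma pm_induct [case_names single add]:
  fixes p :: "'a \<Rightarrow>\<^sub>0 'b::comm_monoid_add"
  assumes "\<And>k v. P (Poly_Mapping.single k v)" and "\<And>p q. P p \<Longrightarrow> P q \<Longrightarrow> P (p + q)"
  shows "P p"
proof -
  have "P (\<Sum>k\<in>A. Poly_Mapping.single k (Poly_Mapping.lookup p k))" if "finite A" for A
    using that
  proof induction
    case empty
    show ?case using assms(1)[of undefined 0] by simp
  qed (simp add: assms)
  moreover have "p = (\<Sum>k\<in>Poly_Mapping.keys p. Poly_Mapping.single k (Poly_Mapping.lookup p k))"
    by (rule poly_mapping_eqI) (simp add: lookup_sum lookup_single when_def in_keys_iff)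
  ultimately show ?thesis by (metis finite_keys)
qed

lemma subsets_card_1: "{S. S \<subseteq> {..<2::nat} \<and> card S = Suc 0} = {{0}, {Suc 0}}"
  by (auto simp: card_Suc_eq)

lemma subsets_card_2_1: "{S. S \<subseteq> {..<Suc 0} \<and> card S = 2} = {}"
  by (auto simp: lessThan_Suc subset_singleton_iff)

lemma subsets_card_0: "{S. S \<subseteq> {..<Suc 0} \<and> card S = 0} = {{}}"
  by (auto simp: lessThan_Suc subset_singleton_iff)

lemma subsets_card_2: "{S. S \<subseteq> {..<2::nat} \<and> card S = 2} = {{..<2}}"
  by (auto dest: card_subset_eq[OF finite_lessThan])

lemma shuffle_sign_simps: "shuffle_sign 2 {0} = 1" "shuffle_sign 2 {Suc 0} = - 1"
  "shuffle_sign n {} = 1" "shuffle_sign n {..<n} = 1"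
proof -
  have "{(i, j). i \<in> {Suc 0} \<and> j \<in> {..<2} - {Suc 0} \<and> j < i} = {(Suc 0, 0)}" by auto
  then show "shuffle_sign 2 {Suc 0} = - 1" by (simp add: shuffle_sign_def del: singleton_iff)
next
  have "{(i, j). i \<in> {0::nat} \<and> j \<in> {..<2} - {0} \<and> j < i} = {}" by auto
  then show "shuffle_sign 2 {0} = 1" by (simp only: shuffle_sign_def card.empty power_0)
qed (auto simp: shuffle_sign_def)

lemma coboundary_op_0: "coboundary_op \<pi> 0 P [h] = - \<pi> [P [], h]"
  by (simp add: coboundary_op_def schouten_def insertion_def subsets_card_0 subsets_card_2_1 shuffle_sign_simps del: card_0_eq)

lemma coboundary_op_1: "coboundary_op \<pi> 1 V [f, g] = \<pi> [V [f], g] - \<pi> [V [g], f] - V [\<pi> [f, g]]"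
proof -
  have [simp]: "length [f, g] = 2" by simp
  show ?thesis
    by (simp add: coboundary_op_def schouten_def insertion_def subsets_card_1 subsets_card_2
        shuffle_sign_simps nths_Cons del: length_Cons list.size)
qed

lemma lookup_pdiff: "Poly_Mapping.lookup (pdiff i p) m =
   of_nat (Poly_Mapping.lookup m i + 1) * Poly_Mapping.lookup p (m + Poly_Mapping.single i 1)"
proof -
  let ?e = "Poly_Mapping.single i (1::nat)"
  have *: "(of_nat (Poly_Mapping.lookup k i) * Poly_Mapping.lookup p k when k - ?e = m)
     = (of_nat (Poly_Mapping.lookup k i) * Poly_Mapping.lookup p k when k = m + ?e)" for k
  proof (cases "Poly_Mapping.lookup k i = 0")
    case False
    have "k - ?e = m \<longleftrightarrow> k = m + ?e"
      using False by (auto simp: poly_mapping_eq_iff fun_eq_iff lookup_add lookup_minus lookup_single when_def)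
    then show ?thesis by simp
  qed simp
  have "Poly_Mapping.lookup (pdiff i p) m = (\<Sum>k\<in>Poly_Mapping.keys p. of_nat (Poly_Mapping.lookup k i) * Poly_Mapping.lookup p k when k = m + ?e)"
    unfolding pdiff_def lookup_sum lookup_single * ..
  also have "\<dots> = of_nat (Poly_Mapping.lookup m i + 1) * Poly_Mapping.lookup p (m + ?e)"
    by (cases "m + ?e \<in> Poly_Mapping.keys p") (simp_all add: when_def lookup_add in_keys_iff)
  finally show ?thesis .
qed

lemma pdiff_add: "pdiff i (p + q) = pdiff i p + pdiff i q"
  by (rule poly_mapping_eqI) (simp add: lookup_pdiff lookup_add distrib_left)

lemma pdiff_single: "pdiff i (Poly_Mapping.single m c) = Poly_Mapping.single (m - Poly_Mapping.single i 1) (of_nat (Poly_Mapping.lookup m i) * c)"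
  by (simp add: pdiff_def)

lemma pdiff_mult: "pdiff i (p * q) = p * pdiff i q + q * pdiff i p"
proof (induction p arbitrary: q rule: pm_induct)
  case (single m c)
  show ?case
  proof (induction q rule: pm_induct)
    case (single n e)
    let ?e = "Poly_Mapping.single i (Suc 0)"
    have 1: "m + n - ?e = m + (n - ?e)" if "Poly_Mapping.lookup n i \<noteq> 0"
      using that by (intro poly_mapping_eqI) (auto simp: lookup_add lookup_minus lookup_single when_def)
    have 2: "m + n - ?e = n + (m - ?e)" if "Poly_Mapping.lookup m i \<noteq> 0"
      using that by (intro poly_mapping_eqI) (auto simp: lookup_add lookup_minus lookup_single when_def)
    have 3: "n + (m - ?e) = m + (n - ?e)" if "Poly_Mapping.lookup m i \<noteq> 0" "Poly_Mapping.lookup n i \<noteq> 0"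
      using 1 2 that by simp
    show ?case
      by (cases "Poly_Mapping.lookup n i = 0"; cases "Poly_Mapping.lookup m i = 0")
        (simp_all add: pdiff_single mult_single lookup_add 1 2 3 single_add algebra_simps)
  qed (simp add: pdiff_add distrib_left distrib_right)
qed (simp add: pdiff_add distrib_left distrib_right)

lemma pdiff_smult3: "pdiff i (smult3 c p) = smult3 c (pdiff i p)"
  by (simp add: smult3_def pdiff_mult pdiff_single)

lemma pdiff_commute: "pdiff i (pdiff j p) = pdiff j (pdiff i p)"
proof (cases "i = j")
  case False
  then show ?thesis
    by (intro poly_mapping_eqI) (simp add: lookup_pdiff lookup_add lookup_single algebra_simps when_def)
qed simp

lemma pdiff_Var: "pdiff i (Var j) = (if i = j then 1 else 0)"
  by (simp add: Var_def pdiff_single lookup_single when_def)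

lemma pdiff_uminus: "pdiff i (- p) = - pdiff i p"
  by (rule poly_mapping_eqI) (simp add: lookup_pdiff)

lemma pdiff_diff: "pdiff i (p - q) = pdiff i p - pdiff i q"
  by (rule poly_mapping_eqI) (simp add: lookup_pdiff lookup_minus algebra_simps)

definition jacobian_bracket :: "'f::field_char_0 poly3 \<Rightarrow> 'f cochain" where
 "jacobian_bracket \<phi> xs = (if length xs = 2 then let f = xs ! 0; g = xs ! 1 in
    pdiff 2 \<phi> * (pdiff 0 f * pdiff 1 g - pdiff 1 f * pdiff 0 g)
  + pdiff 0 \<phi> * (pdiff 1 f * pdiff 2 g - pdiff 2 f * pdiff 1 g)
  + pdiff 1 \<phi> * (pdiff 2 f * pdiff 0 g - pdiff 0 f * pdiff 2 g) else 0)"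

lemma jacobian_bracket_pair: "jacobian_bracket \<phi> [f,g] = 
    pdiff 2 \<phi> * (pdiff 0 f * pdiff 1 g - pdiff 1 f * pdiff 0 g)
  + pdiff 0 \<phi> * (pdiff 1 f * pdiff 2 g - pdiff 2 f * pdiff 1 g)
  + pdiff 1 \<phi> * (pdiff 2 f * pdiff 0 g - pdiff 0 f * pdiff 2 g)"
  by (simp add: jacobian_bracket_def)

lemma jacobian_bracket_jacobi: "jacobian_bracket \<phi> [jacobian_bracket \<phi> [f, g], h] + jacobian_bracket \<phi> [jacobian_bracket \<phi> [g, h], f] + jacobian_bracket \<phi> [jacobian_bracket \<phi> [h, f], g] = 0"
  unfolding jacobian_bracket_pair pdiff_add pdiff_mult pdiff_diff
    pdiff_commute[of 1 0] pdiff_commute[of 2 0] pdiff_commute[of 2 1]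
  by algebra

lemma length_2_cases: assumes "length (xs @ a # ys) = 2"
  shows "(\<exists>g. xs = [] \<and> ys = [g]) \<or> (\<exists>g. xs = [g] \<and> ys = [])"
  using assms by (cases xs; cases ys) auto

lemma jacobian_bracket_multiderivation: "jacobian_bracket \<phi> \<in> multiderivations 2"
proof -
  have s: "smult3 c (a + b) = smult3 c a + smult3 c b" "smult3 c (a * b) = a * smult3 c b" 
     "smult3 c (a - b) = smult3 c a - smult3 c b" for c :: 'a and a b by (simp_all add: smult3_def algebra_simps)
  have z: "length xs \<noteq> 2 \<Longrightarrow> jacobian_bracket \<phi> xs = 0" for xs by (simp add: jacobian_bracket_def)
  have "jacobian_bracket \<phi> (xs @ (f + g) # ys) = jacobian_bracket \<phi> (xs @ f # ys) + jacobian_bracket \<phi> (xs @ g # ys)" for xs ys f g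
    using length_2_cases[of xs f ys] by (cases "length (xs @ f # ys) = 2") (auto simp: z jacobian_bracket_pair pdiff_add algebra_simps)
  moreover have "jacobian_bracket \<phi> (xs @ smult3 c f # ys) = smult3 c (jacobian_bracket \<phi> (xs @ f # ys))" for xs ys f c
    using length_2_cases[of xs f ys] by (cases "length (xs @ f # ys) = 2") (auto simp: z jacobian_bracket_pair pdiff_smult3, auto simp: smult3_def algebra_simps)
  moreover have "jacobian_bracket \<phi> (xs @ (f * g) # ys) = f * jacobian_bracket \<phi> (xs @ g # ys) + g * jacobian_bracket \<phi> (xs @ f # ys)" for xs ys f g
    using length_2_cases[of xs f ys] by (cases "length (xs @ f # ys) = 2") (auto simp: z jacobian_bracket_pair pdiff_mult algebra_simps)
  moreover have "jacobian_bracket \<phi> (xs @ f # g # ys) = - jacobian_bracket \<phi> (xs @ g # f # ys)" for xs ys f g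
  proof (cases "xs = [] \<and> ys = []")
    case True
    then show ?thesis by (simp add: jacobian_bracket_pair algebra_simps)
  next
    case False
    then have "length (xs @ f # g # ys) \<noteq> 2" "length (xs @ g # f # ys) \<noteq> 2" by auto
    then show ?thesis by (simp add: z)
  qed
  ultimately show ?thesis using z unfolding multiderivations_def mem_Collect_eq by blast
qed

lemma biderivation_eq: fixes P Q :: "'f::field_char_0 cochain"
  assumes P: "P \<in> multiderivations 2" and Q: "Q \<in> multiderivations 2"
  and e: "P [Var 0, Var 1] = Q [Var 0, Var 1]" "P [Var 1, Var 2] = Q [Var 1, Var 2]" "P [Var 2, Var 0] = Q [Var 2, Var 0]"
  shows "P = Q"
proof -
  have der: "D = E" if
     "\<And>f g. D (f + g) = D f + D g"  "\<And>f g. D (f * g) = f * D g + g * D f" "\<And>c f. D (smult3 c f) = smult3 c (D f)"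
     "\<And>f g. E (f + g) = E f + E g"  "\<And>f g. E (f * g) = f * E g + g * E f" "\<And>c f. E (smult3 c f) = smult3 c (E f)"
     "\<And>i. D (Var i) = E (Var i)" for D E :: "'f poly3 \<Rightarrow> 'f poly3"
  proof
    fix p
    have [simp]: "D 1 = 0" "E 1 = 0" using that(2)[of 1 1] that(5)[of 1 1] by simp_all
    have 1: "D (Poly_Mapping.single (Poly_Mapping.single i n) 1) = E (Poly_Mapping.single (Poly_Mapping.single i n) 1)" for i n
    proof (induction n)
      case (Suc n)
      have "Poly_Mapping.single (Poly_Mapping.single i (Suc n)) (1::'f) = Var i * Poly_Mapping.single (Poly_Mapping.single i n) 1"
        by (simp add: Var_def mult_single single_add[symmetric])
      with Suc show ?case by (simp add: that)
    qed simp
    have 2: "D (Poly_Mapping.single m 1) = E (Poly_Mapping.single m 1)" for m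
    proof (induction m rule: pm_induct)
      case (add m n)
      have "Poly_Mapping.single (m + n) (1::'f) = Poly_Mapping.single m 1 * Poly_Mapping.single n 1"
        by (simp add: mult_single)
      with add show ?case by (simp add: that)
    qed (rule 1)
    show "D p = E p"
    proof (induction p rule: pm_induct)
      case (single m c)
      have "Poly_Mapping.single m c = smult3 c (Poly_Mapping.single m 1)" by (simp add: smult3_def mult_single)
      then show ?case by (simp add: that 2)
    qed (simp add: that)
  qed
  have sk: "R [f, g] = - R [g, f]" if "R \<in> multiderivations 2" for R :: "'f cochain" and f g
  proof -
    have "\<forall>xs ys f g. R (xs @ f # g # ys) = - R (xs @ g # f # ys)"
      using that unfolding multiderivations_def mem_Collect_eq by blast
    from this[rule_format, of "[]" f g "[]"] show ?thesis by simp
  qed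
  have sk0: "R [f, f] = 0" if "R \<in> multiderivations 2" for R :: "'f cochain" and f
  proof -
    have "2 * R [f, f] = 0" using sk[OF that, of f f] by (metis add.right_inverse mult_2)
    moreover have "R [f,f] = smult3 (1/2) (2 * R [f,f])"
    proof -
      have "(2::'f poly3) = Poly_Mapping.single 0 2" by (metis single_numeral)
      then have "Poly_Mapping.single 0 (1/2 :: 'f) * (2::'f poly3) = Poly_Mapping.single 0 (1/2) * Poly_Mapping.single 0 2"
        by (rule arg_cong)
      also have "\<dots> = 1" by (subst mult_single) simp
      finally show ?thesis by (simp add: smult3_def mult.assoc[symmetric])
    qed
    ultimately show ?thesis by (simp add: smult3_def)
  qed
  have all3: "i = 0 \<or> i = 1 \<or> i = 2" for i :: 3
  proof (induct i)
    case (of_int z)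
    then have "z = 0 \<or> z = 1 \<or> z = 2" by fastforce
    then show ?case by auto
  qed
  have v: "P [Var i, Var j] = Q [Var i, Var j]" for i j
    using all3[of i] all3[of j] e sk[OF P, of "Var 1" "Var 0"] sk[OF P, of "Var 2" "Var 1"] sk[OF P, of "Var 0" "Var 2"]
       sk[OF Q, of "Var 1" "Var 0"] sk[OF Q, of "Var 2" "Var 1"] sk[OF Q, of "Var 0" "Var 2"]
    by (auto simp: sk0[OF P] sk0[OF Q])
  have l: "R [f+g,h] = R [f,h] + R [g,h]" "R [f*g,h] = f * R [g,h] + g * R [f,h]" "R [smult3 c f,h] = smult3 c (R [f,h])"
     "R [h,f+g] = R [h,f] + R [h,g]" "R [h,f*g] = f * R [h,g] + g * R [h,f]" "R [h,smult3 c f] = smult3 c (R [h,f])"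
    if "R \<in> multiderivations 2" for R :: "'f cochain" and f g h c
  proof -
    have *: "R (xs @ (f+g)#ys) = R (xs @ f#ys) + R (xs @ g#ys)" "R (xs @ (f*g)#ys) = f * R (xs @ g#ys) + g * R (xs @ f#ys)"
       "R (xs @ (smult3 c f)#ys) = smult3 c (R (xs @ f#ys))" for xs ys
      using that unfolding multiderivations_def mem_Collect_eq by blast+
    show "R [f+g,h] = R [f,h] + R [g,h]" "R [f*g,h] = f * R [g,h] + g * R [f,h]" "R [smult3 c f,h] = smult3 c (R [f,h])"
     "R [h,f+g] = R [h,f] + R [h,g]" "R [h,f*g] = f * R [h,g] + g * R [h,f]" "R [h,smult3 c f] = smult3 c (R [h,f])"
      using *[of "[]" "[h]"] *[of "[h]" "[]"] by simp_all
  qed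
  have v1: "P [Var i, g] = Q [Var i, g]" for i g
    using der[of "\<lambda>g. P [Var i, g]" "\<lambda>g. Q [Var i, g]"] l[OF P] l[OF Q] v by (metis (no_types, lifting))
  have v2: "P [f, g] = Q [f, g]" for f g
    using der[of "\<lambda>f. P [f, g]" "\<lambda>f. Q [f, g]"] l[OF P] l[OF Q] v1 by (metis (no_types, lifting))
  show ?thesis
  proof
    fix xs
    show "P xs = Q xs"
    proof (cases "length xs = 2")
      case True
      then obtain f g where "xs = [f,g]" by (auto simp: length_Suc_conv numeral_2_eq_2)
      then show ?thesis using v2 by simp
    qed (use P Q in \<open>unfold multiderivations_def mem_Collect_eq, metis\<close>)
  qed
qed

lemma ex1_poisson_bracket:
  "\<exists>!\<pi>. poisson_structure \<pi> \<and> \<pi> [Var 0, Var 1] = pdiff 2 \<phi> \<and> \<pi> [Var 1, Var 2] = pdiff 0 \<phi>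
       \<and> \<pi> [Var 2, Var 0] = pdiff 1 \<phi>"
proof (rule ex1I[of _ "jacobian_bracket \<phi>"])
  show "poisson_structure (jacobian_bracket \<phi>) \<and> jacobian_bracket \<phi> [Var 0, Var 1] = pdiff 2 \<phi> \<and> jacobian_bracket \<phi> [Var 1, Var 2] = pdiff 0 \<phi>
       \<and> jacobian_bracket \<phi> [Var 2, Var 0] = pdiff 1 \<phi>"
    using jacobian_bracket_multiderivation jacobian_bracket_jacobi by (auto simp: poisson_structure_def jacobian_bracket_pair pdiff_Var)
  then show "\<And>\<pi>. poisson_structure \<pi> \<and> \<pi> [Var 0, Var 1] = pdiff 2 \<phi> \<and> \<pi> [Var 1, Var 2] = pdiff 0 \<phi>
       \<and> \<pi> [Var 2, Var 0] = pdiff 1 \<phi> \<Longrightarrow> \<pi> = jacobian_bracket \<phi>"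
    by (intro biderivation_eq) (auto simp: poisson_structure_def)
qed

end

(*
  A biderivation corresponds to a vector W of three polynomials, the given bracket to the gradient
  of phi, and W is a 2-cocycle iff (grad phi) . (curl W) = 0. As the singularity is isolated, the Koszul
  complex of the partial derivatives is exact. Hence curl W = grad phi x U, where U is again a cocycle,
  of smaller weighted degree, and induction on the degree gives W = grad h + g grad phi. So the second
  cohomology is spanned by the classes of the vectors grad h and g grad phi. Since every u grad chi is a
  Poisson structure, (1 + sum g_n nu^n) grad (phi + sum h_n nu^n) is a formal deformation; its mixed
  terms g_i grad h_j constitute Psi.

  If V is a 1-cocycle, f = V . grad phi and g = div V, then grad f = g grad phi. For homogeneous V, the Euler
  formula turns this into (d - (w_0 + w_1 + w_2)) g = - grad phi . curl U for some U. A Casimir g in the image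
  of grad phi . curl vanishes, by descent on its degree; so f = g = 0 and V is a coboundary.
*)
theory Submission
  imports Defs "HOL-Library.Countable_Set"
begin

text \<open>The fields \<open>grad h + g grad phi\<close> are the tangent vectors at
  \<open>(1, phi)\<close> to the family \<open>u grad chi\<close>. Hence, if the basis classes are
  represented by such fields, the deformation can be written down to all orders instead of being
  solved order by order. Linear combinations of these fields have the same shape, so the basis is
  extracted from a countable generating family in which \<open>h\<close> or \<open>g\<close> is a
  monomial and the other is zero. Finite support of the parameters at each order makes
  \<open>h_n\<close> and \<open>g_n\<close> polynomials.

  Finite dimension of the quotient enters through one consequence: some power of each variable lies
  in the Jacobian ideal. Divisibility by such powers can be read off coefficients, and this
  elementary fact carries over to exactness for the partial derivatives.

  The sum of the weights is the divergence of the Euler field, and \<open>d\<close> is the degree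
  lost in passing from \<open>f\<close> to \<open>g\<close>. In the exceptional degree the two
  cancel, and the equation obtained for \<open>g\<close> carries no information.\<close>

abbreviation coef :: "('a \<Rightarrow>\<^sub>0 'b::zero) \<Rightarrow> 'a \<Rightarrow> 'b" where
  "coef \<equiv> Poly_Mapping.lookup"

lemma cases_3: fixes i :: 3 shows "i = 0 \<or> i = 1 \<or> i = 2"
proof (induct i)
  case (of_int z)
  then have "z = 0 \<or> z = 1 \<or> z = 2" by fastforce
  then show ?case by auto
qed

lemma UNIV_3: "(UNIV :: 3 set) = {0, 1, 2}"
  using cases_3 by auto

lemma sum_UNIV_3: "(\<Sum>i\<in>UNIV. f i) = f (0::3) + f 1 + f 2"
  unfolding UNIV_3 by (simp add: add.assoc)

lemma coef_single_mult_add: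
  fixes t m :: "'a::cancel_comm_monoid_add" and p :: "'a \<Rightarrow>\<^sub>0 'b::comm_semiring_1"
  shows "coef (Poly_Mapping.single t c * p) (t + m) = c * coef p m"
  by (induction p rule: pm_induct)
    (simp_all add: mult_single lookup_single when_def distrib_left lookup_add)

lemma coef_single_mult_eq_0:
  fixes t m :: "'a::cancel_comm_monoid_add" and p :: "'a \<Rightarrow>\<^sub>0 'b::comm_semiring_1"
  assumes "\<And>n. m \<noteq> t + n"
  shows "coef (Poly_Mapping.single t c * p) m = 0"
  using assms
  by (induction p rule: pm_induct)
    (auto simp: mult_single lookup_single when_def distrib_left lookup_add)

lemma coef_smult3: "coef (smult3 c p) m = c * coef p m"
  using coef_single_mult_add[of 0 c p m] by (simp add: smult3_def)

lemma coef_of_nat_mult: "coef (of_nat n * p) m = of_nat n * coef (p :: 'f::field_char_0 poly3) m"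
  by (metis coef_smult3 single_of_nat smult3_def)

lemma coef_of_int_mult: "coef (of_int n * p) m = of_int n * coef (p :: 'f::field_char_0 poly3) m"
  by (metis coef_smult3 single_of_int smult3_def)

lemma smult3_mult: "smult3 c p * q = smult3 c (p * q)" "p * smult3 c q = smult3 c (p * q)"
  by (simp_all add: smult3_def algebra_simps)

lemma smult3_add: "smult3 c (p + q) = smult3 c p + smult3 c q"
  by (simp add: smult3_def algebra_simps)

lemma smult3_smult3: "smult3 b (smult3 c p) = smult3 (b * c) p"
  by (rule poly_mapping_eqI) (simp add: coef_smult3)

lemma smult3_one: "smult3 1 p = p"
  by (simp add: smult3_def)

lemma smult3_inverse_of_int: "n \<noteq> 0 \<Longrightarrow> smult3 (inverse (of_int n)) (of_int n * p) = p"
  by (rule poly_mapping_eqI) (simp add: coef_smult3 coef_of_int_mult)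

lemma pdiff_0: "pdiff i 0 = 0"
  by (simp add: pdiff_def)

lemma pdiff_1: "pdiff i 1 = 0"
  using pdiff_mult[of i 1 1] by simp

lemma pdiff_sum: "pdiff i (sum f A) = (\<Sum>a\<in>A. pdiff i (f a))"
  by (induction A rule: infinite_finite_induct) (auto simp: pdiff_add pdiff_0)

lemma pdiff_of_int_mult: "pdiff i (of_int n * p) = of_int n * pdiff i p"
  by (metis pdiff_smult3 single_of_int smult3_def)

lemma pdiff_of_int: "pdiff i (of_int n) = 0"
  using pdiff_of_int_mult[of i n 1] by (simp add: pdiff_1)

lemma pdiff_of_nat: "pdiff i (of_nat n) = 0"
  using pdiff_of_int[of i "int n"] by simp

section \<open>Powers of the variables\<close>

lemma Var_power: "Var i ^ n = Poly_Mapping.single (Poly_Mapping.single i n) (1 :: 'f::field_char_0)"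
  by (induction n) (simp_all add: Var_def mult_single flip: single_add)

lemma exponent_split:
  fixes m :: "3 \<Rightarrow>\<^sub>0 nat"
  assumes "n \<le> coef m i"
  shows "m = Poly_Mapping.single i n + (m - Poly_Mapping.single i n)"
  using assms
  by (intro poly_mapping_eqI) (auto simp: lookup_add lookup_minus lookup_single when_def)

lemma coef_Var_power_mult:
  "coef (Var i ^ n * (p :: 'f::field_char_0 poly3)) (Poly_Mapping.single i n + m) = coef p m"
  unfolding Var_power by (simp add: coef_single_mult_add)

lemma coef_Var_power_mult_eq_0:
  "coef m i < n \<Longrightarrow> coef (Var i ^ n * (p :: 'f::field_char_0 poly3)) m = 0"
  unfolding Var_power by (rule coef_single_mult_eq_0) (auto simp: lookup_add)

lemma Var_power_mult_cancel:
  "Var i ^ n * p = Var i ^ n * (q :: 'f::field_char_0 poly3) \<Longrightarrow> p = q"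
  by (metis coef_Var_power_mult poly_mapping_eqI)

text \<open>Multiplication by a power of a variable shifts exponents injectively, so the quotient is
  \<open>p\<close> read at shifted exponents. The explicit coefficients of the remainder turn
  divisibility into a test on coefficients.\<close>

lemma Var_power_division:
  fixes p :: "'f::field_char_0 poly3"
  obtains s r where "p = Var i ^ n * s + r"
    and "\<And>m. coef r m = (if coef m i < n then coef p m else 0)"
proof
  let ?t = "Poly_Mapping.single i n"
  define s where "s = Poly_Mapping.map_key ((+) ?t) p"
  define r where "r = p - Var i ^ n * s"
  have s: "coef s m = coef p (?t + m)" for m
    by (simp add: s_def Poly_Mapping.map_key.rep_eq)
  show "p = Var i ^ n * s + r" by (simp add: r_def)
  show "coef r m = (if coef m i < n then coef p m else 0)" for m
  proof (cases "coef m i < n")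
    case False
    define k where "k = m - ?t"
    have m: "m = ?t + k" unfolding k_def using False by (intro exponent_split) simp
    show ?thesis
      using False unfolding m by (simp add: r_def lookup_minus coef_Var_power_mult s)
  qed (simp add: r_def lookup_minus coef_Var_power_mult_eq_0)
qed

lemma Var_power_dvd_iff:
  fixes p :: "'f::field_char_0 poly3"
  shows "Var i ^ n dvd p \<longleftrightarrow> (\<forall>m. coef m i < n \<longrightarrow> coef p m = 0)"
proof
  assume *: "\<forall>m. coef m i < n \<longrightarrow> coef p m = 0"
  obtain s r where p: "p = Var i ^ n * s + r"
    and r: "\<And>m. coef r m = (if coef m i < n then coef p m else 0)"
    by (rule Var_power_division[of p i n]) blast
  have "r = 0" using r * by (intro poly_mapping_eqI) simp
  then show "Var i ^ n dvd p" using p by simp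
qed (auto simp: coef_Var_power_mult_eq_0)

text \<open>Multiplication by a power of another variable leaves the exponent of
  \<open>Var i\<close> unchanged, so low exponents on the left match low exponents on the right,
  where they are absent.\<close>

lemma Var_power_dvd_cancel:
  fixes p q :: "'f::field_char_0 poly3"
  assumes "i \<noteq> j" and "Var j ^ k * p = Var i ^ n * q"
  shows "Var i ^ n dvd p"
  unfolding Var_power_dvd_iff
proof (intro allI impI)
  fix m :: "3 \<Rightarrow>\<^sub>0 nat" assume "coef m i < n"
  then have "coef (Var i ^ n * q) (Poly_Mapping.single j k + m) = 0"
    using assms(1) by (intro coef_Var_power_mult_eq_0) (simp add: lookup_add lookup_single when_def)
  then show "coef p m = 0"
    by (metis assms(2) coef_Var_power_mult)
qed

text \<open>The ideal of the two powers is monomial: it suffices to kill the coefficients of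
  \<open>p\<close> at exponents that are low in both \<open>i\<close> and \<open>j\<close>, and
  shifting in direction \<open>h\<close> preserves this condition.\<close>

lemma Var_power_cancel_mod_two:
  fixes p q r :: "'f::field_char_0 poly3"
  assumes ne: "h \<noteq> i" "h \<noteq> j" and eq: "Var h ^ k * p = Var i ^ n * q + Var j ^ l * r"
  shows "\<exists>s t. p = Var i ^ n * s + Var j ^ l * t"
proof -
  obtain s u where p: "p = Var i ^ n * s + u"
    and u: "\<And>m. coef u m = (if coef m i < n then coef p m else 0)"
    by (rule Var_power_division[of p i n]) blast
  have "coef u m = 0" if "coef m j < l" for m
  proof (cases "coef m i < n")
    case True
    then have "coef (Var i ^ n * q) (Poly_Mapping.single h k + m) = 0"
      "coef (Var j ^ l * r) (Poly_Mapping.single h k + m) = 0"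
      using that ne by (auto intro!: coef_Var_power_mult_eq_0 simp: lookup_add lookup_single when_def)
    then have "coef (Var h ^ k * p) (Poly_Mapping.single h k + m) = 0"
      by (simp add: eq lookup_add)
    then have "coef p m = 0"
      by (metis coef_Var_power_mult)
    then show ?thesis by (simp add: u)
  qed (simp add: u)
  then have "Var j ^ l dvd u"
    by (simp add: Var_power_dvd_iff)
  then show ?thesis using p by (auto simp: dvd_def)
qed

section \<open>Koszul exactness\<close>

text \<open>
  Both lemmas are instances of depth sensitivity of the Koszul complex: powers of \<open>x\<close>, \<open>y\<close>, \<open>z\<close>
  form a regular sequence and annihilate the Koszul homology of any ideal that contains them, so a
  cycle can be divided by one power after another.
\<close>

lemma koszul_cross_exact:
  fixes f0 f1 f2 a b c :: "'f::field_char_0 poly3"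
  assumes X: "Var 0 ^ l = x0 * f0 + x1 * f1 + x2 * f2"
    and Y: "Var 1 ^ m = y0 * f0 + y1 * f1 + y2 * f2"
    and cyc: "f1 * c = f2 * b" "f2 * a = f0 * c" "f0 * b = f1 * a"
  shows "\<exists>g. a = g * f0 \<and> b = g * f1 \<and> c = g * f2"
proof -
  define X where "X = (Var 0 ^ l :: 'f poly3)"
  \<comment> \<open>Contraction of the cycle with the coefficients that express \<open>X\<close>.
    Since \<open>(a, b, c)\<close> is parallel to \<open>(f0, f1, f2)\<close>, it is the multiplier
    for \<open>X\<close> times the cycle; it remains to divide it by \<open>X\<close>, using
    \<open>Y\<close>.\<close>
  define e where "e = x0 * a + x1 * b + x2 * c"
  have e: "X * a = e * f0" "X * b = e * f1" "X * c = e * f2"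
    unfolding X_def X e_def using cyc by algebra+
  have "Var 1 ^ m * e = X * (y0 * a + y1 * b + y2 * c)"
    unfolding Y using e by algebra
  then have "X dvd e"
    unfolding X_def by (intro Var_power_dvd_cancel[of 0 1]) simp_all
  then obtain s where s: "e = X * s" by (auto simp: dvd_def)
  have "X * a = X * (s * f0)" "X * b = X * (s * f1)" "X * c = X * (s * f2)"
    using e unfolding s by (simp_all only: mult.assoc)
  then have "a = s * f0" "b = s * f1" "c = s * f2"
    unfolding X_def by (blast dest: Var_power_mult_cancel)+
  then show ?thesis by blast
qed

lemma koszul_dot_exact:
  fixes f0 f1 f2 a b c :: "'f::field_char_0 poly3"
  assumes X: "Var 0 ^ l = x0 * f0 + x1 * f1 + x2 * f2"
    and Y: "Var 1 ^ m = y0 * f0 + y1 * f1 + y2 * f2"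
    and Z: "Var 2 ^ n = z0 * f0 + z1 * f1 + z2 * f2"
    and cyc: "a * f0 + b * f1 + c * f2 = 0"
  shows "\<exists>u v t. a = f1 * t - f2 * v \<and> b = f2 * u - f0 * t \<and> c = f0 * v - f1 * u"
proof -
  define X where "X = (Var 0 ^ l :: 'f poly3)"
  define Y where "Y = (Var 1 ^ m :: 'f poly3)"
  define Z where "Z = (Var 2 ^ n :: 'f poly3)"
  \<comment> \<open>The cross product of \<open>(a, b, c)\<close> with \<open>(x0, x1, x2)\<close>.
    By the double cross product formula its cross product with \<open>(f0, f1, f2)\<close> returns
    \<open>X\<close> times the cycle, since the cycle is orthogonal to
    \<open>(f0, f1, f2)\<close>.\<close>
  define p q r where "p = b * x2 - c * x1" and "q = c * x0 - a * x2" and "r = a * x1 - b * x0"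
  have Xa: "X * a = f1 * r - f2 * q" "X * b = f2 * p - f0 * r" "X * c = f0 * q - f1 * p"
    unfolding assms(1)[folded X_def] p_def q_def r_def using cyc by algebra+
  \<comment> \<open>The same formula with the coefficients of \<open>Y\<close>: modulo
    \<open>X\<close>, the vector \<open>Y (p, q, r)\<close> is \<open>e (f0, f1, f2)\<close>.
    Pairing with the coefficients of \<open>Z\<close> then places \<open>Z * e\<close> in the ideal
    of \<open>X\<close> and \<open>Y\<close>.\<close>
  define e where "e = y0 * p + y1 * q + y2 * r"
  have Ye: "Y * p = f0 * e - X * (y1 * c - y2 * b)" "Y * q = f1 * e - X * (y2 * a - y0 * c)"
    "Y * r = f2 * e - X * (y0 * b - y1 * a)"
    unfolding assms(2)[folded Y_def] e_def using Xa by algebra+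
  have "Z * e = X * (z0 * (y1 * c - y2 * b) + z1 * (y2 * a - y0 * c) + z2 * (y0 * b - y1 * a))
      + Y * (z0 * p + z1 * q + z2 * r)"
    unfolding assms(3)[folded Z_def] using Ye by algebra
  then obtain s t where e: "e = X * s + Y * t"
    unfolding X_def Y_def Z_def using Var_power_cancel_mod_two[of 2 0 1] by fastforce
  have dvd: "X dvd u" if "Y * u = X * v" for u v
    using Var_power_dvd_cancel[of 0 1 m u l v] that by (simp add: X_def Y_def)
  \<comment> \<open>Multiples of \<open>(f0, f1, f2)\<close> vanish in the cross product with it, so
    subtracting \<open>t (f0, f1, f2)\<close> is free and makes \<open>(p, q, r)\<close> divisible
    by \<open>X\<close>.\<close>
  have "Y * (p - f0 * t) = X * (f0 * s - (y1 * c - y2 * b))"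
    "Y * (q - f1 * t) = X * (f1 * s - (y2 * a - y0 * c))"
    "Y * (r - f2 * t) = X * (f2 * s - (y0 * b - y1 * a))"
    using Ye unfolding e by algebra+
  then have "X dvd p - f0 * t" "X dvd q - f1 * t" "X dvd r - f2 * t"
    by (blast intro: dvd)+
  then obtain u v k where "p = f0 * t + X * u" "q = f1 * t + X * v" "r = f2 * t + X * k"
    by (metis (no_types, opaque_lifting) add_diff_cancel_left' diff_add_cancel dvd_def add.commute)
  with Xa have "X * a = X * (f1 * k - f2 * v)" "X * b = X * (f2 * u - f0 * k)"
    "X * c = X * (f0 * v - f1 * u)"
    by algebra+
  then show ?thesis unfolding X_def by (blast dest: Var_power_mult_cancel)
qed

section \<open>Weighted degrees\<close>

text \<open>Degrees are integers, so lowering them by a weight or by \<open>d\<close> never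
  truncates, and components of negative degree simply vanish.\<close>

definition wdeg :: "(3 \<Rightarrow> nat) \<Rightarrow> (3 \<Rightarrow>\<^sub>0 nat) \<Rightarrow> int" where
  "wdeg w m = (\<Sum>i\<in>UNIV. int (w i * coef m i))"

definition hpart :: "(3 \<Rightarrow> nat) \<Rightarrow> int \<Rightarrow> 'f::field_char_0 poly3 \<Rightarrow> 'f poly3" where
  "hpart w k = Poly_Mapping.mapp (\<lambda>m c. if wdeg w m = k then c else 0)"

definition homogeneous :: "(3 \<Rightarrow> nat) \<Rightarrow> int \<Rightarrow> 'f::field_char_0 poly3 \<Rightarrow> bool" where
  "homogeneous w k p \<longleftrightarrow> hpart w k p = p"

lemma coef_hpart: "coef (hpart w k p) m = (if wdeg w m = k then coef p m else 0)"
  by (simp add: hpart_def lookup_mapp when_def in_keys_iff)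

lemma homogeneous_iff: "homogeneous w k p \<longleftrightarrow> (\<forall>m. coef p m \<noteq> 0 \<longrightarrow> wdeg w m = k)"
  unfolding homogeneous_def poly_mapping_eq_iff fun_eq_iff coef_hpart by auto

lemma wdeg_add: "wdeg w (m + n) = wdeg w m + wdeg w n"
  by (simp add: wdeg_def lookup_add distrib_left sum.distrib)

lemma wdeg_single: "wdeg w (Poly_Mapping.single i n) = int (w i * n)"
proof -
  have "wdeg w (Poly_Mapping.single i n) = (\<Sum>j\<in>UNIV. if j = i then int (w i * n) else 0)"
    unfolding wdeg_def by (rule sum.cong) (auto simp: lookup_single when_def)
  then show ?thesis by (simp add: UNIV_3) (use cases_3[of i] in auto)
qed

lemma wdeg_nonneg: "0 \<le> wdeg w m"
  unfolding wdeg_def by (rule sum_nonneg) simp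

lemma homogeneous_hpart: "homogeneous w k (hpart w k p)"
  by (simp add: homogeneous_iff coef_hpart)

lemma hpart_0: "hpart w k 0 = 0"
  by (rule poly_mapping_eqI) (simp add: coef_hpart)

lemma hpart_add: "hpart w k (p + q) = hpart w k p + hpart w k q"
  by (rule poly_mapping_eqI) (simp add: coef_hpart lookup_add)

lemma hpart_diff: "hpart w k (p - q) = hpart w k p - hpart w k q"
  by (rule poly_mapping_eqI) (simp add: coef_hpart lookup_minus)

lemma hpart_sum: "hpart w k (sum f A) = (\<Sum>a\<in>A. hpart w k (f a))"
  by (induction A rule: infinite_finite_induct) (auto simp: hpart_add hpart_0)

lemma hpart_homogeneous: "homogeneous w j p \<Longrightarrow> hpart w k p = (if k = j then p else 0)"
  unfolding homogeneous_iff
  by (rule poly_mapping_eqI) (auto simp: coef_hpart)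

lemma hpart_smult3: "hpart w k (smult3 c p) = smult3 c (hpart w k p)"
  by (rule poly_mapping_eqI) (simp add: coef_hpart coef_smult3)

lemma hpart_pdiff: "hpart w k (pdiff i p) = pdiff i (hpart w (k + int (w i)) p)"
  by (rule poly_mapping_eqI) (simp add: coef_hpart lookup_pdiff wdeg_add wdeg_single)

lemma hpart_single:
  "hpart w k (Poly_Mapping.single m c) = (if wdeg w m = k then Poly_Mapping.single m c else 0)"
  by (rule poly_mapping_eqI) (auto simp: coef_hpart lookup_single when_def)

lemma hpart_mult_hpart: "hpart w k (p * hpart w e q) = hpart w (k - e) p * hpart w e q"
proof (induction p rule: pm_induct)
  case (single m a)
  show ?case
    by (induction q rule: pm_induct)
      (auto simp: hpart_single mult_single wdeg_add hpart_0 hpart_add distrib_left)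
qed (simp add: distrib_right hpart_add)

lemma hpart_mult_right:
  "homogeneous w e q \<Longrightarrow> hpart w k (p * q) = hpart w (k - e) p * q"
  unfolding homogeneous_def using hpart_mult_hpart[of w k p e q] by simp

lemma hpart_mult_left:
  "homogeneous w e q \<Longrightarrow> hpart w k (q * p) = q * hpart w (k - e) p"
  using hpart_mult_right[of w e q k p] by (simp add: mult.commute)

lemma homogeneous_mult:
  "homogeneous w j p \<Longrightarrow> homogeneous w k q \<Longrightarrow> homogeneous w (j + k) (p * q)"
  using hpart_mult_right[of w k q "j + k" p] by (simp add: homogeneous_def)

lemma homogeneous_0: "homogeneous w k 0"
  by (simp add: homogeneous_def hpart_0)

lemma homogeneous_add: "homogeneous w k p \<Longrightarrow> homogeneous w k q \<Longrightarrow> homogeneous w k (p + q)"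
  by (simp add: homogeneous_def hpart_add)

lemma homogeneous_smult3: "homogeneous w k p \<Longrightarrow> homogeneous w k (smult3 c p)"
  by (simp add: homogeneous_def hpart_smult3)

lemma homogeneous_pdiff: "homogeneous w k p \<Longrightarrow> homogeneous w (k - int (w i)) (pdiff i p)"
  by (simp add: homogeneous_def hpart_pdiff)

lemma homogeneous_Var_power: "homogeneous w (int (w i * n)) (Var i ^ n)"
  by (simp add: homogeneous_def Var_power hpart_single wdeg_single)

lemma homogeneous_of_nat_Var_mult:
  assumes "homogeneous w (k - int (w i)) p"
  shows "homogeneous w k (of_nat n * Var i * p)"
proof -
  have "homogeneous w (int (w i) + (k - int (w i))) (Var i * p)"
    using homogeneous_mult[OF homogeneous_Var_power[of w i 1] assms] by simp
  then have "homogeneous w k (smult3 (of_nat n) (Var i * p))"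
    by (intro homogeneous_smult3) simp
  then show ?thesis by (simp add: smult3_def mult.assoc)
qed

lemma homogeneous_neg: "homogeneous w k p \<Longrightarrow> k < 0 \<Longrightarrow> p = 0"
  unfolding homogeneous_iff using wdeg_nonneg[of w]
  by (intro poly_mapping_eqI) (metis lookup_zero not_less)

lemma sum_hpart:
  assumes "finite I" and "\<And>m. coef p m \<noteq> 0 \<Longrightarrow> wdeg w m + j \<in> I"
  shows "(\<Sum>k\<in>I. hpart w (k - j) p) = p"
proof (rule poly_mapping_eqI)
  fix m
  have "coef (\<Sum>k\<in>I. hpart w (k - j) p) m = (\<Sum>k\<in>I. if k = wdeg w m + j then coef p m else 0)"
    unfolding lookup_sum by (rule sum.cong) (auto simp: coef_hpart)
  then show "coef (\<Sum>k\<in>I. hpart w (k - j) p) m = coef p m"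
    using assms by auto
qed

lemma coef_Var_pdiff:
  "coef (of_nat n * Var i * pdiff i p) m = of_nat (n * coef m i) * coef (p :: 'f::field_char_0 poly3) m"
proof -
  have "coef (Var i * pdiff i p) m = of_nat (coef m i) * coef p m"
  proof (cases "coef m i = 0")
    case True
    then show ?thesis
      using coef_Var_power_mult_eq_0[of m i 1 "pdiff i p"] by simp
  next
    case False
    define k where "k = m - Poly_Mapping.single i 1"
    have m: "m = Poly_Mapping.single i 1 + k"
      unfolding k_def using False by (intro exponent_split) simp
    show ?thesis
      using coef_Var_power_mult[of i 1 "pdiff i p" k]
      unfolding m by (simp add: lookup_pdiff lookup_add algebra_simps)
  qed
  then show ?thesis by (simp add: mult.assoc coef_of_nat_mult)
qed

lemma coef_euler:
  fixes p :: "'f::field_char_0 poly3"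
  shows "coef (of_nat (w 0) * Var 0 * pdiff 0 p + of_nat (w 1) * Var 1 * pdiff 1 p
       + of_nat (w 2) * Var 2 * pdiff 2 p) m = of_int (wdeg w m) * coef p m"
  unfolding lookup_add coef_Var_pdiff wdeg_def sum_UNIV_3 by (simp add: algebra_simps)

lemma euler:
  fixes p :: "'f::field_char_0 poly3"
  assumes "homogeneous w k p"
  shows "of_nat (w 0) * Var 0 * pdiff 0 p + of_nat (w 1) * Var 1 * pdiff 1 p
       + of_nat (w 2) * Var 2 * pdiff 2 p = of_int k * p"
proof (rule poly_mapping_eqI)
  fix m
  have "of_int (wdeg w m) * coef p m = of_int k * coef p m"
    using assms by (cases "coef p m = 0") (auto simp: homogeneous_iff)
  then show "coef (of_nat (w 0) * Var 0 * pdiff 0 p + of_nat (w 1) * Var 1 * pdiff 1 p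
       + of_nat (w 2) * Var 2 * pdiff 2 p) m = coef (of_int k * p) m"
    by (simp only: coef_euler coef_of_int_mult)
qed

lemma weight_homogeneous_imp_homogeneous:
  fixes p :: "'f::field_char_0 poly3"
  assumes "weight_homogeneous w d p"
  shows "homogeneous w (int d) p"
  unfolding homogeneous_iff
proof (intro allI impI)
  fix m assume nz: "coef p m \<noteq> 0"
  have "of_int (wdeg w m) * coef p m = coef (of_nat d * p) m"
    using assms coef_euler[of w p m] by (simp add: weight_homogeneous_def)
  then have "(of_int (wdeg w m) :: 'f) = of_int (int d)"
    using nz by (simp add: coef_of_nat_mult)
  then show "wdeg w m = int d" by (simp only: of_int_eq_iff)
qed

text \<open>The homotopy formula: contraction with the Euler field inverts the gradient up to the degree.\<close>

lemma poincare:
  fixes a b c :: "'f::field_char_0 poly3"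
  assumes hom: "homogeneous w (k - int (w 0)) a" "homogeneous w (k - int (w 1)) b"
    "homogeneous w (k - int (w 2)) c"
    and curl: "pdiff 1 c = pdiff 2 b" "pdiff 2 a = pdiff 0 c" "pdiff 0 b = pdiff 1 a"
    and "k \<noteq> 0"
  shows "\<exists>h. homogeneous w k h \<and> a = pdiff 0 h \<and> b = pdiff 1 h \<and> c = pdiff 2 h"
proof -
  define h where "h = of_nat (w 0) * Var 0 * a + of_nat (w 1) * Var 1 * b + of_nat (w 2) * Var 2 * c"
  \<comment> \<open>Vanishing curl turns the derivatives of the other components into those of the
    component at hand. This is the Euler formula in degree \<open>k - w i\<close>, and the product
    rule supplies the missing \<open>w i\<close>.\<close>
  have "pdiff 0 h = of_int k * a" "pdiff 1 h = of_int k * b" "pdiff 2 h = of_int k * c"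
    using euler[OF hom(1)] euler[OF hom(2)] euler[OF hom(3)] curl
    by (simp_all add: h_def pdiff_add pdiff_mult pdiff_Var pdiff_of_nat mult.assoc algebra_simps)
  then have "pdiff 0 (smult3 (inverse (of_int k)) h) = a" "pdiff 1 (smult3 (inverse (of_int k)) h) = b"
    "pdiff 2 (smult3 (inverse (of_int k)) h) = c"
    using \<open>k \<noteq> 0\<close> by (simp_all add: pdiff_smult3 smult3_inverse_of_int)
  moreover have "homogeneous w k (smult3 (inverse (of_int k)) h)"
    unfolding h_def by (intro homogeneous_smult3 homogeneous_add homogeneous_of_nat_Var_mult hom)
  ultimately show ?thesis by metis
qed

section \<open>The Jacobian ideal of an isolated singularity\<close>

interpretation poly3: vector_space "smult3 :: 'f::field_char_0 \<Rightarrow> 'f poly3 \<Rightarrow> 'f poly3"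
  by unfold_locales
    (simp_all add: smult3_add smult3_smult3 smult3_one, simp add: smult3_def single_add distrib_right)

lemma jacobian_ideal_add:
  assumes "p \<in> jacobian_ideal \<phi>" "q \<in> jacobian_ideal \<phi>"
  shows "p + q \<in> jacobian_ideal \<phi>"
proof -
  obtain a b c a' b' c' where "p = a * pdiff 0 \<phi> + b * pdiff 1 \<phi> + c * pdiff 2 \<phi>"
    "q = a' * pdiff 0 \<phi> + b' * pdiff 1 \<phi> + c' * pdiff 2 \<phi>"
    using assms by (auto simp: jacobian_ideal_def)
  then have "p + q = (a + a') * pdiff 0 \<phi> + (b + b') * pdiff 1 \<phi> + (c + c') * pdiff 2 \<phi>"
    by (simp add: algebra_simps)
  then show ?thesis by (auto simp: jacobian_ideal_def)
qed

lemma jacobian_ideal_mult: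
  assumes "p \<in> jacobian_ideal \<phi>"
  shows "q * p \<in> jacobian_ideal \<phi>"
proof -
  obtain a b c where "p = a * pdiff 0 \<phi> + b * pdiff 1 \<phi> + c * pdiff 2 \<phi>"
    using assms by (auto simp: jacobian_ideal_def)
  then have "q * p = (q * a) * pdiff 0 \<phi> + (q * b) * pdiff 1 \<phi> + (q * c) * pdiff 2 \<phi>"
    by (simp add: algebra_simps)
  then show ?thesis by (auto simp: jacobian_ideal_def)
qed

lemma jacobian_ideal_subspace: "poly3.subspace (jacobian_ideal \<phi>)"
proof -
  have "0 \<in> jacobian_ideal \<phi>"
    by (auto simp: jacobian_ideal_def intro!: exI[of _ 0])
  then show ?thesis
    by (auto simp: poly3.subspace_def smult3_def intro: jacobian_ideal_add jacobian_ideal_mult)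
qed

lemma hpart_jacobian_ideal:
  assumes "homogeneous w d \<phi>" and "p \<in> jacobian_ideal \<phi>"
  shows "hpart w k p \<in> jacobian_ideal \<phi>"
proof -
  obtain a b c where "p = a * pdiff 0 \<phi> + b * pdiff 1 \<phi> + c * pdiff 2 \<phi>"
    using assms(2) by (auto simp: jacobian_ideal_def)
  then show ?thesis
    by (auto simp: jacobian_ideal_def hpart_add hpart_mult_right[OF homogeneous_pdiff[OF assms(1)]])
qed

text \<open>Otherwise the quotient is zero, and the coefficient family with constant value
  \<open>1\<close> violates independence because \<mu> is positive.\<close>

lemma one_notin_jacobian_ideal:
  assumes "isolated_singularity (\<phi> :: 'f::field_char_0 poly3)"
  shows "1 \<notin> jacobian_ideal \<phi>"
proof
  assume "1 \<in> jacobian_ideal \<phi>"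
  then have U: "jacobian_ideal \<phi> = UNIV"
    using jacobian_ideal_mult[of 1 \<phi>] by auto
  obtain \<mu> :: nat and b where "\<mu> \<ge> 1" and b: "classes_basis smult3 UNIV (jacobian_ideal \<phi>) {..<\<mu>} b"
    using assms by (auto simp: isolated_singularity_def quotient_has_dim_def)
  have indep: "\<forall>k\<in>{..<\<mu>}. c k = 0"
    if "lincomb smult3 {..<\<mu>} c b +o jacobian_ideal \<phi> = jacobian_ideal \<phi>" for c
    using b that unfolding classes_basis_def by simp
  have "p +o jacobian_ideal \<phi> = jacobian_ideal \<phi>" for p
    unfolding U elt_set_plus_def by auto (metis add.commute diff_add_cancel)
  then have "\<forall>k\<in>{..<\<mu>}. (\<lambda>_. 1 :: 'f) k = 0"
    by (rule indep)
  then show False using \<open>\<mu> \<ge> 1\<close> by fastforce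
qed

text \<open>
  The powers \<open>1\<close>, \<open>x\<close>, \<open>x\<^sup>2\<close>, ... are linearly dependent modulo the ideal, and the ideal contains the
  homogeneous components of such a relation.
\<close>

lemma Var_power_in_jacobian_ideal:
  fixes \<phi> :: "'f::field_char_0 poly3"
  assumes "isolated_singularity \<phi>" and hom: "homogeneous w d \<phi>" and "0 < w v"
  shows "\<exists>n. Var v ^ n \<in> jacobian_ideal \<phi>"
proof (rule ccontr)
  let ?J = "jacobian_ideal \<phi>"
  assume no: "\<not> ?thesis"
  obtain \<mu> :: nat and b where b: "classes_basis smult3 UNIV ?J {..<\<mu>} b"
    using assms by (auto simp: isolated_singularity_def quotient_has_dim_def)
  have "\<exists>q \<in> poly3.span (b ` {..<\<mu>}). p - q \<in> ?J" for p
  proof -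
    have "p +o ?J \<in> classes UNIV ?J" by (simp add: classes_def)
    then obtain c where c: "p +o ?J = lincomb smult3 {..<\<mu>} c b +o ?J"
      using b unfolding classes_basis_def by blast
    have "p \<in> p +o ?J"
      using poly3.subspace_0[OF jacobian_ideal_subspace] by (force simp: elt_set_plus_def)
    then have "p - lincomb smult3 {..<\<mu>} c b \<in> ?J"
      unfolding c by (auto simp: elt_set_plus_def)
    moreover have "lincomb smult3 {..<\<mu>} c b \<in> poly3.span (b ` {..<\<mu>})"
      unfolding lincomb_def by (intro poly3.span_sum poly3.span_scale poly3.span_base) auto
    ultimately show ?thesis by blast
  qed
  then obtain q where q: "\<And>p. q p \<in> poly3.span (b ` {..<\<mu>})" "\<And>p. p - q p \<in> ?J"
    by metis
  \<comment> \<open>Each \<open>r i\<close> represents the power \<open>Var v ^ i\<close> modulo the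
    ideal and lies in a span of \<mu> vectors; with \<open>i\<close> running up to \<mu> there is
    one vector too many.\<close>
  define r where "r = (\<lambda>i. q (Var v ^ i))"
  have indep: "\<forall>i\<le>n. c i = 0" if "(\<Sum>i\<le>n. smult3 (c i) (r i)) = 0" for c :: "nat \<Rightarrow> 'f" and n
  proof (intro allI impI)
    fix j assume "j \<le> n"
    have "(\<Sum>i\<le>n. smult3 (c i) (Var v ^ i - r i)) \<in> ?J"
      unfolding r_def using jacobian_ideal_subspace q(2)
      by (intro poly3.subspace_sum poly3.subspace_scale) auto
    then have "(\<Sum>i\<le>n. smult3 (c i) (Var v ^ i)) \<in> ?J"
      using that by (simp add: poly3.scale_right_diff_distrib sum_subtractf)
    \<comment> \<open>Since \<open>w v\<close> is positive, distinct powers have distinct degrees,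
      and this component isolates the term \<open>i = j\<close>.\<close>
    then have "hpart w (int (w v * j)) (\<Sum>i\<le>n. smult3 (c i) (Var v ^ i)) \<in> ?J"
      by (rule hpart_jacobian_ideal[OF hom])
    also have "hpart w (int (w v * j)) (\<Sum>i\<le>n. smult3 (c i) (Var v ^ i))
        = (\<Sum>i\<le>n. if i = j then smult3 (c i) (Var v ^ i) else 0)"
      unfolding hpart_sum hpart_smult3
      by (rule sum.cong) (use \<open>0 < w v\<close> in \<open>auto simp: hpart_homogeneous[OF homogeneous_Var_power]\<close>)
    also have "\<dots> = smult3 (c j) (Var v ^ j)"
      using \<open>j \<le> n\<close> by simp
    finally have "smult3 (inverse (c j)) (smult3 (c j) (Var v ^ j)) \<in> ?J"
      by (rule poly3.subspace_scale[OF jacobian_ideal_subspace])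
    then show "c j = 0" using no by (cases "c j = 0") (auto simp: smult3_smult3 smult3_one)
  qed
  have inj: "inj_on r {..\<mu>}"
  proof (rule inj_onI, rule ccontr)
    fix i j assume ij: "i \<in> {..\<mu>}" "j \<in> {..\<mu>}" "r i = r j" "i \<noteq> j"
    \<comment> \<open>A repetition would be the relation \<open>r i - r j = 0\<close>; injectivity
      is needed because independence below is that of a set, not of a family.\<close>
    define c :: "nat \<Rightarrow> 'f" where "c = (\<lambda>k. (if k = i then 1 else 0) - (if k = j then 1 else 0))"
    have "(\<Sum>k\<le>\<mu>. smult3 (c k) (r k))
       = (\<Sum>k\<le>\<mu>. (if k = i then r k else 0) - (if k = j then r k else 0))"
      by (rule sum.cong) (auto simp: c_def poly3.scale_left_diff_distrib smult3_one)
    also have "\<dots> = 0" using ij by (simp add: sum_subtractf)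
    finally have "c i = 0" using indep ij(1) by blast
    then show False using ij by (simp add: c_def)
  qed
  have "poly3.independent (r ` {..\<mu>})"
  proof
    assume "poly3.dependent (r ` {..\<mu>})"
    then obtain u where u: "\<exists>p\<in>r ` {..\<mu>}. u p \<noteq> 0" "(\<Sum>p\<in>r ` {..\<mu>}. smult3 (u p) p) = 0"
      by (auto simp: poly3.dependent_finite)
    then have "(\<Sum>i\<le>\<mu>. smult3 (u (r i)) (r i)) = 0"
      by (simp add: sum.reindex[OF inj] comp_def)
    then show False using indep[of "\<lambda>i. u (r i)"] u(1) by auto
  qed
  then have "card (r ` {..\<mu>}) \<le> card (b ` {..<\<mu>})"
    using poly3.independent_span_bound[of "b ` {..<\<mu>}" "r ` {..\<mu>}"] q(1) by (auto simp: r_def)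
  also have "\<dots> \<le> \<mu>" using card_image_le[of "{..<\<mu>}" b] by simp
  finally show False by (simp add: card_image[OF inj])
qed

section \<open>Exactness for the gradient of \<phi> and the decomposition of 2-cocycles\<close>

locale isolated_quasihomogeneous =
  fixes w :: "3 \<Rightarrow> nat" and d :: nat and \<phi> :: "'f::field_char_0 poly3"
  assumes weight_pos: "0 < w i"
    and homogeneous_phi: "homogeneous w (int d) \<phi>"
    and isolated: "isolated_singularity \<phi>"
begin

lemma homogeneous_pdiff_phi: "homogeneous w (int d - int (w i)) (pdiff i \<phi>)"
  by (rule homogeneous_pdiff[OF homogeneous_phi])

lemma Var_power_eq: "\<exists>n a b c. Var i ^ n = a * pdiff 0 \<phi> + b * pdiff 1 \<phi> + c * pdiff 2 \<phi>"
  using Var_power_in_jacobian_ideal[OF isolated homogeneous_phi weight_pos]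
  by (simp add: jacobian_ideal_def)

text \<open>In vector notation \<open>(a, b, c)\<close> is the cross product of
  \<open>grad phi\<close> with \<open>U = (u, v, t)\<close>; these letters keep this meaning
  below.\<close>

lemma dot_exact:
  assumes "a * pdiff 0 \<phi> + b * pdiff 1 \<phi> + c * pdiff 2 \<phi> = 0"
  shows "\<exists>u v t. a = pdiff 1 \<phi> * t - pdiff 2 \<phi> * v \<and> b = pdiff 2 \<phi> * u - pdiff 0 \<phi> * t
    \<and> c = pdiff 0 \<phi> * v - pdiff 1 \<phi> * u"
  using Var_power_eq[of 0] Var_power_eq[of 1] Var_power_eq[of 2] koszul_dot_exact[OF _ _ _ assms]
  by metis

lemma cross_exact:
  assumes "pdiff 1 \<phi> * c = pdiff 2 \<phi> * b" "pdiff 2 \<phi> * a = pdiff 0 \<phi> * c"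
    "pdiff 0 \<phi> * b = pdiff 1 \<phi> * a"
  shows "\<exists>g. a = g * pdiff 0 \<phi> \<and> b = g * pdiff 1 \<phi> \<and> c = g * pdiff 2 \<phi>"
  using Var_power_eq[of 0] Var_power_eq[of 1] koszul_cross_exact[OF _ _ assms]
  by metis

text \<open>In degree zero the partial derivatives would have negative degree and vanish, yet they
  generate a power of a variable. Positivity makes both descents on the degree terminate.\<close>

lemma degree_pos: "0 < d"
proof (rule ccontr)
  assume "\<not> 0 < d"
  then have "pdiff i \<phi> = 0" for i
    using homogeneous_neg[OF homogeneous_pdiff_phi[of i]] weight_pos[of i] by simp
  then obtain n where "Var 0 ^ n = (0 :: 'f poly3)"
    using Var_power_eq[of 0] by auto
  then show False
    using Var_power_mult_cancel[of 0 n "1 :: 'f poly3" 0] by (metis mult_zero_left zero_neq_one)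
qed

text \<open>Positive weights leave only constants in degree zero, and a nonzero constant would bring
  \<open>1\<close> into the ideal.\<close>

lemma homogeneous_degree_0_jacobian_ideal:
  assumes "homogeneous w 0 p" and "p \<in> jacobian_ideal \<phi>"
  shows "p = 0"
proof (rule ccontr)
  assume "p \<noteq> 0"
  have "coef p m = 0" if "m \<noteq> 0" for m
  proof (rule ccontr)
    assume "coef p m \<noteq> 0"
    then have "wdeg w m = 0" using assms(1) by (simp add: homogeneous_iff)
    then have "int (w i * coef m i) = 0" for i
      unfolding wdeg_def by (subst (asm) sum_nonneg_eq_0_iff) auto
    then have "coef m i = 0" for i
      using weight_pos[of i] by (metis mult_eq_0_iff of_nat_eq_0_iff less_irrefl)
    then show False using that by (metis lookup_zero poly_mapping_eqI)
  qed
  then have p: "p = smult3 (coef p 0) 1"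
    by (intro poly_mapping_eqI) (auto simp: coef_smult3 lookup_one when_def)
  then have "coef p 0 \<noteq> 0" using \<open>p \<noteq> 0\<close> by auto
  then have "smult3 (inverse (coef p 0)) p = 1"
    by (subst p) (simp add: smult3_smult3 smult3_one)
  then have "1 \<in> jacobian_ideal \<phi>"
    using poly3.subspace_scale[OF jacobian_ideal_subspace assms(2)] by metis
  then show False using one_notin_jacobian_ideal[OF isolated] by simp
qed

text \<open>The index \<open>k\<close> is normalised by the gradient of a polynomial of degree
  \<open>k\<close>; for \<open>k \<le> 0\<close> all components have negative degree. Homogeneity of
  \<open>h\<close> is part of the induction because the correction term below must be homogeneous
  for \<open>poincare\<close>.\<close>

lemma cocycle_decomposition_homogeneous:
  assumes "homogeneous w (k - int (w 0)) a" "homogeneous w (k - int (w 1)) b"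
    "homogeneous w (k - int (w 2)) c"
    and "pdiff 0 \<phi> * (pdiff 1 c - pdiff 2 b) + pdiff 1 \<phi> * (pdiff 2 a - pdiff 0 c)
      + pdiff 2 \<phi> * (pdiff 0 b - pdiff 1 a) = 0"
  shows "\<exists>h g. homogeneous w k h \<and> a = pdiff 0 h + g * pdiff 0 \<phi> \<and> b = pdiff 1 h + g * pdiff 1 \<phi>
      \<and> c = pdiff 2 h + g * pdiff 2 \<phi>"
  using assms
proof (induction "nat k" arbitrary: k a b c rule: less_induct)
  case less
  note hom = less.prems(1-3)
  show ?case
  proof (cases "k \<le> 0")
    case True
    then have "a = 0" "b = 0" "c = 0"
      using hom weight_pos[of 0] weight_pos[of 1] weight_pos[of 2]
      by (auto intro!: homogeneous_neg)
    then show ?thesis by (auto intro!: exI[of _ 0] simp: homogeneous_0 pdiff_0)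
  next
    case False
    obtain u v t where
      "pdiff 1 c - pdiff 2 b = pdiff 1 \<phi> * t - pdiff 2 \<phi> * v"
      "pdiff 2 a - pdiff 0 c = pdiff 2 \<phi> * u - pdiff 0 \<phi> * t"
      "pdiff 0 b - pdiff 1 a = pdiff 0 \<phi> * v - pdiff 1 \<phi> * u"
      using dot_exact less.prems(4) by (metis mult.commute)
    \<comment> \<open>Homogeneous parts replace \<open>U\<close> by a field with index
      \<open>k - d\<close>, to which the induction hypothesis can apply.\<close>
    then have
      "hpart w (k - int (w 1) - int (w 2)) (pdiff 1 c - pdiff 2 b)
        = hpart w (k - int (w 1) - int (w 2)) (pdiff 1 \<phi> * t - pdiff 2 \<phi> * v)"
      "hpart w (k - int (w 2) - int (w 0)) (pdiff 2 a - pdiff 0 c)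
        = hpart w (k - int (w 2) - int (w 0)) (pdiff 2 \<phi> * u - pdiff 0 \<phi> * t)"
      "hpart w (k - int (w 0) - int (w 1)) (pdiff 0 b - pdiff 1 a)
        = hpart w (k - int (w 0) - int (w 1)) (pdiff 0 \<phi> * v - pdiff 1 \<phi> * u)"
      by simp_all
    moreover define u' v' t' where "u' = hpart w (k - int d - int (w 0)) u"
      and "v' = hpart w (k - int d - int (w 1)) v" and "t' = hpart w (k - int d - int (w 2)) t"
    ultimately have curl:
      "pdiff 1 c - pdiff 2 b = pdiff 1 \<phi> * t' - pdiff 2 \<phi> * v'"
      "pdiff 2 a - pdiff 0 c = pdiff 2 \<phi> * u' - pdiff 0 \<phi> * t'"
      "pdiff 0 b - pdiff 1 a = pdiff 0 \<phi> * v' - pdiff 1 \<phi> * u'"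
      using hom
      by (simp_all add: hpart_diff hpart_pdiff hpart_mult_left[OF homogeneous_pdiff_phi] hpart_mult_right[OF homogeneous_pdiff_phi]
          homogeneous_def algebra_simps)
    \<comment> \<open>A curl has no divergence, whereas the divergence of
      \<open>grad phi x U\<close> is \<open>- grad phi . curl U\<close>; so \<open>U\<close> solves
      the same equation.\<close>
    have "pdiff 0 (pdiff 1 c - pdiff 2 b) + pdiff 1 (pdiff 2 a - pdiff 0 c) + pdiff 2 (pdiff 0 b - pdiff 1 a) = 0"
      by (simp add: pdiff_diff pdiff_commute[of 1 0] pdiff_commute[of 2 0] pdiff_commute[of 2 1])
    then have "pdiff 0 \<phi> * (pdiff 1 t' - pdiff 2 v') + pdiff 1 \<phi> * (pdiff 2 u' - pdiff 0 t')
      + pdiff 2 \<phi> * (pdiff 0 v' - pdiff 1 u') = 0"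
      unfolding curl pdiff_diff pdiff_mult
        pdiff_commute[of 1 0] pdiff_commute[of 2 0] pdiff_commute[of 2 1] by algebra
    then obtain h' g' where h': "homogeneous w (k - int d) h'"
      "u' = pdiff 0 h' + g' * pdiff 0 \<phi>" "v' = pdiff 1 h' + g' * pdiff 1 \<phi>"
      "t' = pdiff 2 h' + g' * pdiff 2 \<phi>"
      using less.hyps[of "k - int d" u' v' t'] degree_pos False homogeneous_hpart
      unfolding u'_def v'_def t'_def by fastforce
    have *: "homogeneous w (k - int (w i)) (p + h' * pdiff i \<phi>)"
      if "homogeneous w (k - int (w i)) p" for p i
      using homogeneous_add[OF that] homogeneous_mult[OF h'(1) homogeneous_pdiff_phi[of i]] by simp
    \<comment> \<open>The multiple of \<open>grad phi\<close> in \<open>U\<close> drops out of the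
      cross product, so \<open>curl W = grad phi x grad h' = - curl (h' grad phi)\<close>, and
      \<open>W + h' grad phi\<close> is a gradient.\<close>
    have "\<exists>h. homogeneous w k h \<and> a + h' * pdiff 0 \<phi> = pdiff 0 h \<and> b + h' * pdiff 1 \<phi> = pdiff 1 h
       \<and> c + h' * pdiff 2 \<phi> = pdiff 2 h"
      using curl False unfolding h'(2-4)
      by (intro poincare * hom)
        (simp_all add: pdiff_add pdiff_mult pdiff_commute[of 1 0] pdiff_commute[of 2 0]
          pdiff_commute[of 2 1] algebra_simps)
    then obtain h where "homogeneous w k h" "a = pdiff 0 h + (- h') * pdiff 0 \<phi>"
      "b = pdiff 1 h + (- h') * pdiff 1 \<phi>" "c = pdiff 2 h + (- h') * pdiff 2 \<phi>"
      by (metis (no_types, lifting) add_diff_cancel_right' diff_conv_add_uminus mult_minus_left)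
    then show ?thesis by blast
  qed
qed

lemma cocycle_decomposition:
  assumes "pdiff 0 \<phi> * (pdiff 1 c - pdiff 2 b) + pdiff 1 \<phi> * (pdiff 2 a - pdiff 0 c)
      + pdiff 2 \<phi> * (pdiff 0 b - pdiff 1 a) = 0"
  shows "\<exists>h g. a = pdiff 0 h + g * pdiff 0 \<phi> \<and> b = pdiff 1 h + g * pdiff 1 \<phi>
      \<and> c = pdiff 2 h + g * pdiff 2 \<phi>"
proof -
  define hp where "hp = (\<lambda>k i. hpart w (k - int (w i)) :: 'f poly3 \<Rightarrow> 'f poly3)"
  have "\<exists>h g. hp k 0 a = pdiff 0 h + g * pdiff 0 \<phi> \<and> hp k 1 b = pdiff 1 h + g * pdiff 1 \<phi>
      \<and> hp k 2 c = pdiff 2 h + g * pdiff 2 \<phi>" for k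
  proof -
    \<comment> \<open>The common degree of the three products when the field has index
      \<open>k\<close>; the equation thus splits into one equation for each index.\<close>
    have "hpart w (k + int d - int (w 0) - int (w 1) - int (w 2))
      (pdiff 0 \<phi> * (pdiff 1 c - pdiff 2 b) + pdiff 1 \<phi> * (pdiff 2 a - pdiff 0 c)
      + pdiff 2 \<phi> * (pdiff 0 b - pdiff 1 a)) = 0"
      unfolding assms by (rule hpart_0)
    then have "pdiff 0 \<phi> * (pdiff 1 (hp k 2 c) - pdiff 2 (hp k 1 b))
      + pdiff 1 \<phi> * (pdiff 2 (hp k 0 a) - pdiff 0 (hp k 2 c))
      + pdiff 2 \<phi> * (pdiff 0 (hp k 1 b) - pdiff 1 (hp k 0 a)) = 0"
      by (simp add: hp_def hpart_add hpart_diff hpart_pdiff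
          hpart_mult_left[OF homogeneous_pdiff_phi] hpart_mult_right[OF homogeneous_pdiff_phi]
          algebra_simps)
    then show ?thesis
      using cocycle_decomposition_homogeneous[of k "hp k 0 a" "hp k 1 b" "hp k 2 c"]
      unfolding hp_def using homogeneous_hpart by blast
  qed
  then obtain h g where hg: "\<And>k. hp k 0 a = pdiff 0 (h k) + g k * pdiff 0 \<phi>"
    "\<And>k. hp k 1 b = pdiff 1 (h k) + g k * pdiff 1 \<phi>" "\<And>k. hp k 2 c = pdiff 2 (h k) + g k * pdiff 2 \<phi>"
    by metis
  define I where "I = (\<lambda>m. wdeg w m + int (w 0)) ` Poly_Mapping.keys a
    \<union> (\<lambda>m. wdeg w m + int (w 1)) ` Poly_Mapping.keys b \<union> (\<lambda>m. wdeg w m + int (w 2)) ` Poly_Mapping.keys c"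
  have "(\<Sum>k\<in>I. hp k 0 a) = a" "(\<Sum>k\<in>I. hp k 1 b) = b" "(\<Sum>k\<in>I. hp k 2 c) = c"
    unfolding hp_def by (rule sum_hpart; auto simp: I_def in_keys_iff)+
  then have "a = pdiff 0 (\<Sum>k\<in>I. h k) + (\<Sum>k\<in>I. g k) * pdiff 0 \<phi>"
    "b = pdiff 1 (\<Sum>k\<in>I. h k) + (\<Sum>k\<in>I. g k) * pdiff 1 \<phi>"
    "c = pdiff 2 (\<Sum>k\<in>I. h k) + (\<Sum>k\<in>I. g k) * pdiff 2 \<phi>"
    unfolding hg by (simp_all add: pdiff_sum sum.distrib sum_distrib_right)
  then show ?thesis by blast
qed

end

section \<open>Casimirs and the vanishing of the first cohomology\<close>

lemma sum_pdiff_euler: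
  fixes g :: "'f::field_char_0 poly3"
  assumes "homogeneous w k g"
  shows "pdiff 0 (g * (of_nat (w 0) * Var 0)) + pdiff 1 (g * (of_nat (w 1) * Var 1))
    + pdiff 2 (g * (of_nat (w 2) * Var 2)) = of_int (k + int (w 0 + w 1 + w 2)) * g"
  \<comment> \<open>The divergence of \<open>g\<close> times the Euler field: the Euler formula
    contributes \<open>k\<close>, the divergence of the Euler field the sum of the weights.\<close>
  using euler[OF assms] by (simp add: pdiff_mult pdiff_Var pdiff_of_nat algebra_simps)

context isolated_quasihomogeneous
begin

lemma dot_curl_smult3:
  assumes "n \<noteq> 0" and "of_int n * g = pdiff 0 \<phi> * (pdiff 1 c - pdiff 2 b)
      + pdiff 1 \<phi> * (pdiff 2 a - pdiff 0 c) + pdiff 2 \<phi> * (pdiff 0 b - pdiff 1 a)"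
  shows "\<exists>a b c. g = pdiff 0 \<phi> * (pdiff 1 c - pdiff 2 b)
      + pdiff 1 \<phi> * (pdiff 2 a - pdiff 0 c) + pdiff 2 \<phi> * (pdiff 0 b - pdiff 1 a)"
proof -
  let ?s = "smult3 (inverse (of_int n)) :: 'f poly3 \<Rightarrow> 'f poly3"
  have "g = ?s (of_int n * g)"
    using smult3_inverse_of_int[OF assms(1), of g] by simp
  also have "\<dots> = pdiff 0 \<phi> * (pdiff 1 (?s c) - pdiff 2 (?s b))
      + pdiff 1 \<phi> * (pdiff 2 (?s a) - pdiff 0 (?s c)) + pdiff 2 \<phi> * (pdiff 0 (?s b) - pdiff 1 (?s a))"
    unfolding assms(2) by (simp add: smult3_add pdiff_smult3 smult3_mult flip: poly3.scale_right_diff_distrib)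
  finally show ?thesis by blast
qed

text \<open>
  The gradient of such a \<open>g\<close> is a multiple \<open>g1\<close> of the gradient of \<open>\<phi>\<close>. By the Euler formula, the
  hypotheses on \<open>g\<close> are inherited by \<open>g1\<close>, which has smaller degree.
\<close>

lemma casimir_exact_eq_0:
  assumes "homogeneous w k g"
    and "pdiff 1 \<phi> * pdiff 2 g = pdiff 2 \<phi> * pdiff 1 g" "pdiff 2 \<phi> * pdiff 0 g = pdiff 0 \<phi> * pdiff 2 g"
      "pdiff 0 \<phi> * pdiff 1 g = pdiff 1 \<phi> * pdiff 0 g"
    and "\<exists>a b c. g = pdiff 0 \<phi> * (pdiff 1 c - pdiff 2 b)
      + pdiff 1 \<phi> * (pdiff 2 a - pdiff 0 c) + pdiff 2 \<phi> * (pdiff 0 b - pdiff 1 a)"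
  shows "g = 0"
  using assms
proof (induction "nat k" arbitrary: k g rule: less_induct)
  case less
  obtain a b c where abc: "g = pdiff 0 \<phi> * (pdiff 1 c - pdiff 2 b)
      + pdiff 1 \<phi> * (pdiff 2 a - pdiff 0 c) + pdiff 2 \<phi> * (pdiff 0 b - pdiff 1 a)"
    using less.prems(5) by blast
  consider "k < 0" | "k = 0" | "k > 0" by linarith
  then show ?case
  proof cases
    case 1
    then show ?thesis using homogeneous_neg less.prems(1) by blast
  next
    case 2
    have "g = (pdiff 1 c - pdiff 2 b) * pdiff 0 \<phi> + (pdiff 2 a - pdiff 0 c) * pdiff 1 \<phi>
      + (pdiff 0 b - pdiff 1 a) * pdiff 2 \<phi>"
      by (simp add: abc mult.commute)
    then have "g \<in> jacobian_ideal \<phi>"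
      unfolding jacobian_ideal_def by blast
    then show ?thesis
      using homogeneous_degree_0_jacobian_ideal less.prems(1) 2 by blast
  next
    case 3
    obtain g1' where g1': "\<And>i. i \<in> {0, 1, 2} \<Longrightarrow> pdiff i g = g1' * pdiff i \<phi>"
      using cross_exact[OF less.prems(2-4)] by auto
    define g1 where "g1 = hpart w (k - int d) g1'"
    have hom1: "homogeneous w (k - int d) g1"
      unfolding g1_def by (rule homogeneous_hpart)
    have "pdiff i g = g1 * pdiff i \<phi>" if "i \<in> {0, 1, 2}" for i
    proof -
      have "pdiff i g = hpart w (k - int (w i)) (pdiff i g)"
        using homogeneous_pdiff[OF less.prems(1)] by (simp add: homogeneous_def)
      also have "\<dots> = g1 * pdiff i \<phi>"
        unfolding g1'[OF that] hpart_mult_right[OF homogeneous_pdiff_phi] by (simp add: g1_def)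
      finally show ?thesis .
    qed
    then have grad: "pdiff 0 g = g1 * pdiff 0 \<phi>" "pdiff 1 g = g1 * pdiff 1 \<phi>"
      "pdiff 2 g = g1 * pdiff 2 \<phi>"
      by blast+
    have kg: "of_int k * g = g1 * (of_nat (w 0) * Var 0 * pdiff 0 \<phi> + of_nat (w 1) * Var 1 * pdiff 1 \<phi>
       + of_nat (w 2) * Var 2 * pdiff 2 \<phi>)"
      using euler[OF less.prems(1)] unfolding grad by (simp add: algebra_simps)
    \<comment> \<open>Two expressions of \<open>k g\<close> as a product with
      \<open>grad phi\<close>, one from the curl and one from the Euler field, differ by a field
      orthogonal to \<open>grad phi\<close>. Taking its divergence removes the curl.\<close>
    then have "(of_int k * (pdiff 1 c - pdiff 2 b) - g1 * (of_nat (w 0) * Var 0)) * pdiff 0 \<phi>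
      + (of_int k * (pdiff 2 a - pdiff 0 c) - g1 * (of_nat (w 1) * Var 1)) * pdiff 1 \<phi>
      + (of_int k * (pdiff 0 b - pdiff 1 a) - g1 * (of_nat (w 2) * Var 2)) * pdiff 2 \<phi> = 0"
      unfolding abc by algebra
    then obtain u v t where
      "of_int k * (pdiff 1 c - pdiff 2 b) - g1 * (of_nat (w 0) * Var 0) = pdiff 1 \<phi> * t - pdiff 2 \<phi> * v"
      "of_int k * (pdiff 2 a - pdiff 0 c) - g1 * (of_nat (w 1) * Var 1) = pdiff 2 \<phi> * u - pdiff 0 \<phi> * t"
      "of_int k * (pdiff 0 b - pdiff 1 a) - g1 * (of_nat (w 2) * Var 2) = pdiff 0 \<phi> * v - pdiff 1 \<phi> * u"
      using dot_exact by blast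
    then have eu:
      "g1 * (of_nat (w 0) * Var 0) = of_int k * (pdiff 1 c - pdiff 2 b) - pdiff 1 \<phi> * t + pdiff 2 \<phi> * v"
      "g1 * (of_nat (w 1) * Var 1) = of_int k * (pdiff 2 a - pdiff 0 c) - pdiff 2 \<phi> * u + pdiff 0 \<phi> * t"
      "g1 * (of_nat (w 2) * Var 2) = of_int k * (pdiff 0 b - pdiff 1 a) - pdiff 0 \<phi> * v + pdiff 1 \<phi> * u"
      by algebra+
    have "of_int (k - int d + int (w 0 + w 1 + w 2)) * g1 = pdiff 0 \<phi> * (pdiff 1 t - pdiff 2 v)
      + pdiff 1 \<phi> * (pdiff 2 u - pdiff 0 t) + pdiff 2 \<phi> * (pdiff 0 v - pdiff 1 u)"
      unfolding sum_pdiff_euler[OF hom1, symmetric] eu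
      by (simp add: pdiff_add pdiff_diff pdiff_of_int pdiff_mult pdiff_commute[of 1 0]
          pdiff_commute[of 2 0] pdiff_commute[of 2 1] algebra_simps)
    \<comment> \<open>For \<open>k < d\<close> the factor may vanish, but then \<open>g1\<close> has
      negative degree.\<close>
    moreover have "k - int d + int (w 0 + w 1 + w 2) \<noteq> 0" if "d \<le> k"
      using that weight_pos[of 0] by linarith
    \<comment> \<open>\<open>g1 grad phi\<close> is the gradient of \<open>g\<close>, so its curl
      \<open>grad g1 x grad phi\<close> is zero.\<close>
    moreover have "pdiff 1 \<phi> * pdiff 2 g1 = pdiff 2 \<phi> * pdiff 1 g1"
      "pdiff 2 \<phi> * pdiff 0 g1 = pdiff 0 \<phi> * pdiff 2 g1" "pdiff 0 \<phi> * pdiff 1 g1 = pdiff 1 \<phi> * pdiff 0 g1"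
      using pdiff_commute[of 1 2 g] pdiff_commute[of 2 0 g] pdiff_commute[of 0 1 g]
      unfolding grad pdiff_mult pdiff_commute[of 1 0] pdiff_commute[of 2 0] pdiff_commute[of 2 1]
      by algebra+
    ultimately have "g1 = 0"
      using less.hyps[OF _ hom1] homogeneous_neg[OF hom1] dot_curl_smult3 degree_pos 3
      by (cases "d \<le> k") auto
    then have "of_int k * g = 0" by (simp add: kg)
    then show ?thesis using 3 smult3_inverse_of_int[of k g] by (simp add: smult3_def)
  qed
qed

lemma cocycle_1_homogeneous:
  assumes ne: "d \<noteq> w 0 + w 1 + w 2"
    and hom: "homogeneous w (k - int d + int (w 0)) a" "homogeneous w (k - int d + int (w 1)) b"
      "homogeneous w (k - int d + int (w 2)) c"
    and f: "f = a * pdiff 0 \<phi> + b * pdiff 1 \<phi> + c * pdiff 2 \<phi>"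
    and g: "g = pdiff 0 a + pdiff 1 b + pdiff 2 c"
    and grad: "pdiff 0 f = g * pdiff 0 \<phi>" "pdiff 1 f = g * pdiff 1 \<phi>" "pdiff 2 f = g * pdiff 2 \<phi>"
  shows "f = 0 \<and> g = 0"
proof -
  have homf: "homogeneous w k f"
    unfolding f using homogeneous_mult[OF hom(1) homogeneous_pdiff_phi[of 0]]
      homogeneous_mult[OF hom(2) homogeneous_pdiff_phi[of 1]]
      homogeneous_mult[OF hom(3) homogeneous_pdiff_phi[of 2]]
    by (intro homogeneous_add) simp_all
  have homg: "homogeneous w (k - int d) g"
    unfolding g using homogeneous_pdiff[OF hom(1), of 0] homogeneous_pdiff[OF hom(2), of 1]
      homogeneous_pdiff[OF hom(3), of 2]
    by (intro homogeneous_add) simp_all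
  show ?thesis
  proof (cases "k = 0")
    case True
    have "f \<in> jacobian_ideal \<phi>" unfolding f jacobian_ideal_def by blast
    then show ?thesis
      using homogeneous_degree_0_jacobian_ideal homogeneous_neg[OF homg] homf degree_pos True by simp
  next
    case False
    have kf: "of_int k * f = g * (of_nat (w 0) * Var 0 * pdiff 0 \<phi> + of_nat (w 1) * Var 1 * pdiff 1 \<phi>
       + of_nat (w 2) * Var 2 * pdiff 2 \<phi>)"
      using euler[OF homf] unfolding grad by (simp add: algebra_simps)
    then have "(of_int k * a - g * (of_nat (w 0) * Var 0)) * pdiff 0 \<phi>
      + (of_int k * b - g * (of_nat (w 1) * Var 1)) * pdiff 1 \<phi>
      + (of_int k * c - g * (of_nat (w 2) * Var 2)) * pdiff 2 \<phi> = 0"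
      unfolding f by algebra
    then obtain u v t where
      "of_int k * a - g * (of_nat (w 0) * Var 0) = pdiff 1 \<phi> * t - pdiff 2 \<phi> * v"
      "of_int k * b - g * (of_nat (w 1) * Var 1) = pdiff 2 \<phi> * u - pdiff 0 \<phi> * t"
      "of_int k * c - g * (of_nat (w 2) * Var 2) = pdiff 0 \<phi> * v - pdiff 1 \<phi> * u"
      using dot_exact by blast
    then have eu: "g * (of_nat (w 0) * Var 0) = of_int k * a - pdiff 1 \<phi> * t + pdiff 2 \<phi> * v"
      "g * (of_nat (w 1) * Var 1) = of_int k * b - pdiff 2 \<phi> * u + pdiff 0 \<phi> * t"
      "g * (of_nat (w 2) * Var 2) = of_int k * c - pdiff 0 \<phi> * v + pdiff 1 \<phi> * u"
      by algebra+
    \<comment> \<open>Here the field \<open>k V\<close> itself has divergence \<open>k g\<close>;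
      subtracting it frees the factor from \<open>k\<close>, so one excluded degree \<open>d\<close>
      serves all components.\<close>
    have "of_int (int (w 0 + w 1 + w 2) - int d) * g
      = of_int (k - int d + int (w 0 + w 1 + w 2)) * g - of_int k * g"
      by (simp add: algebra_simps)
    also have "\<dots> = pdiff 0 \<phi> * (pdiff 1 t - pdiff 2 v)
      + pdiff 1 \<phi> * (pdiff 2 u - pdiff 0 t) + pdiff 2 \<phi> * (pdiff 0 v - pdiff 1 u)"
      unfolding sum_pdiff_euler[OF homg, symmetric] eu
      by (simp add: g pdiff_add pdiff_diff pdiff_of_int pdiff_mult pdiff_commute[of 1 0]
          pdiff_commute[of 2 0] pdiff_commute[of 2 1] algebra_simps)
    finally have "\<exists>a b c. g = pdiff 0 \<phi> * (pdiff 1 c - pdiff 2 b)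
      + pdiff 1 \<phi> * (pdiff 2 a - pdiff 0 c) + pdiff 2 \<phi> * (pdiff 0 b - pdiff 1 a)"
      using ne by (intro dot_curl_smult3[of "int (w 0 + w 1 + w 2) - int d"]) simp_all
    moreover have "pdiff 1 \<phi> * pdiff 2 g = pdiff 2 \<phi> * pdiff 1 g"
      "pdiff 2 \<phi> * pdiff 0 g = pdiff 0 \<phi> * pdiff 2 g" "pdiff 0 \<phi> * pdiff 1 g = pdiff 1 \<phi> * pdiff 0 g"
      using pdiff_commute[of 1 2 f] pdiff_commute[of 2 0 f] pdiff_commute[of 0 1 f]
      unfolding grad pdiff_mult pdiff_commute[of 1 0] pdiff_commute[of 2 0] pdiff_commute[of 2 1]
      by algebra+
    ultimately have "g = 0" by (rule casimir_exact_eq_0[OF homg, rotated -1])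
    moreover from this have "of_int k * f = 0" by (simp add: kf)
    ultimately show ?thesis using False smult3_inverse_of_int[of k f] by (simp add: smult3_def)
  qed
qed

text \<open>Once \<open>f\<close> and \<open>g\<close> vanish, \<open>V = grad phi x U\<close>, and
  \<open>div V = 0\<close> is the 2-cocycle equation for \<open>U\<close>. Hence
  \<open>U = grad h + e grad phi\<close>, whose second summand the cross product
  annihilates.\<close>

lemma cocycle_1_exact:
  assumes ne: "d \<noteq> w 0 + w 1 + w 2"
    and f: "f = a * pdiff 0 \<phi> + b * pdiff 1 \<phi> + c * pdiff 2 \<phi>"
    and g: "g = pdiff 0 a + pdiff 1 b + pdiff 2 c"
    and grad: "pdiff 0 f = g * pdiff 0 \<phi>" "pdiff 1 f = g * pdiff 1 \<phi>" "pdiff 2 f = g * pdiff 2 \<phi>"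
  shows "\<exists>h. a = pdiff 1 \<phi> * pdiff 2 h - pdiff 2 \<phi> * pdiff 1 h
    \<and> b = pdiff 2 \<phi> * pdiff 0 h - pdiff 0 \<phi> * pdiff 2 h \<and> c = pdiff 0 \<phi> * pdiff 1 h - pdiff 1 \<phi> * pdiff 0 h"
proof -
  have parts: "hpart w k f = 0 \<and> hpart w (k - int d) g = 0" for k
  proof (rule cocycle_1_homogeneous[OF ne homogeneous_hpart homogeneous_hpart homogeneous_hpart])
    show "hpart w k f = hpart w (k - int d + int (w 0)) a * pdiff 0 \<phi>
      + hpart w (k - int d + int (w 1)) b * pdiff 1 \<phi> + hpart w (k - int d + int (w 2)) c * pdiff 2 \<phi>"
      unfolding f hpart_add hpart_mult_right[OF homogeneous_pdiff_phi] by (simp add: algebra_simps)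
    show "hpart w (k - int d) g = pdiff 0 (hpart w (k - int d + int (w 0)) a)
      + pdiff 1 (hpart w (k - int d + int (w 1)) b) + pdiff 2 (hpart w (k - int d + int (w 2)) c)"
      unfolding g hpart_add hpart_pdiff ..
    have "pdiff i (hpart w k f) = hpart w (k - int d) g * pdiff i \<phi>" if "pdiff i f = g * pdiff i \<phi>" for i
    proof -
      have "pdiff i (hpart w k f) = hpart w (k - int (w i)) (g * pdiff i \<phi>)"
        unfolding that[symmetric] hpart_pdiff by simp
      then show ?thesis unfolding hpart_mult_right[OF homogeneous_pdiff_phi] by simp
    qed
    then show "pdiff 0 (hpart w k f) = hpart w (k - int d) g * pdiff 0 \<phi>"
      "pdiff 1 (hpart w k f) = hpart w (k - int d) g * pdiff 1 \<phi>"
      "pdiff 2 (hpart w k f) = hpart w (k - int d) g * pdiff 2 \<phi>"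
      using grad by blast+
  qed
  have eq_0: "p = 0" if "\<And>k. hpart w k p = 0" for p :: "'f poly3"
    by (rule poly_mapping_eqI) (metis coef_hpart lookup_zero that)
  have "f = 0" by (rule eq_0) (use parts in blast)
  have "g = 0"
  proof (rule eq_0)
    show "hpart w k g = 0" for k using parts[of "k + int d"] by simp
  qed
  obtain u v t where V: "a = pdiff 1 \<phi> * t - pdiff 2 \<phi> * v" "b = pdiff 2 \<phi> * u - pdiff 0 \<phi> * t"
    "c = pdiff 0 \<phi> * v - pdiff 1 \<phi> * u"
    using dot_exact f \<open>f = 0\<close> by metis
  have "pdiff 0 \<phi> * (pdiff 1 t - pdiff 2 v) + pdiff 1 \<phi> * (pdiff 2 u - pdiff 0 t)
      + pdiff 2 \<phi> * (pdiff 0 v - pdiff 1 u) = - g"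
    unfolding g V by (simp add: pdiff_diff pdiff_mult pdiff_commute[of 1 0]
          pdiff_commute[of 2 0] pdiff_commute[of 2 1] algebra_simps)
  then obtain h e where "u = pdiff 0 h + e * pdiff 0 \<phi>" "v = pdiff 1 h + e * pdiff 1 \<phi>"
    "t = pdiff 2 h + e * pdiff 2 \<phi>"
    using cocycle_decomposition[of t v u] \<open>g = 0\<close> by auto
  then show ?thesis unfolding V by (intro exI[of _ h]) (simp add: algebra_simps)
qed

end

section \<open>Brackets conformal to a Jacobian bracket\<close>

text \<open>Abstract in the ring so that one Jacobi identity serves both the polynomials and the
  power series in \<nu> over them.\<close>

locale commuting_derivations =
  fixes D :: "3 \<Rightarrow> 'r::idom \<Rightarrow> 'r"
  assumes D_add: "D i (f + g) = D i f + D i g"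
    and D_mult: "D i (f * g) = f * D i g + g * D i f"
    and D_commute: "D i (D j f) = D j (D i f)"
begin

lemma D_diff: "D i (f - g) = D i f - D i g"
  using D_add[of i "f - g" g] by simp

definition jac :: "'r \<Rightarrow> 'r \<Rightarrow> 'r \<Rightarrow> 'r" where
  "jac \<chi> f g = D 2 \<chi> * (D 0 f * D 1 g - D 1 f * D 0 g) + D 0 \<chi> * (D 1 f * D 2 g - D 2 f * D 1 g)
     + D 1 \<chi> * (D 2 f * D 0 g - D 0 f * D 2 g)"

lemma jac_jacobi: "jac \<chi> (jac \<chi> f g) h + jac \<chi> (jac \<chi> g h) f + jac \<chi> (jac \<chi> h f) g = 0"
  unfolding jac_def D_add D_mult D_diff D_commute[of 1 0] D_commute[of 2 0] D_commute[of 2 1]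
  by algebra

lemma jac_mult: "jac \<chi> (u * f) g = u * jac \<chi> f g + f * jac \<chi> u g"
  unfolding jac_def D_mult by algebra

text \<open>In three dimensions the wedge square of a bivector vanishes; this is its value on
  \<open>f, g, u, h\<close>. It cancels the terms in which the bracket differentiates the conformal
  factor.\<close>

lemma jac_plucker: "jac \<chi> f g * jac \<chi> u h + jac \<chi> g h * jac \<chi> u f + jac \<chi> h f * jac \<chi> u g = 0"
  unfolding jac_def by algebra

lemma conformal_jacobi:
  "u * jac \<chi> (u * jac \<chi> f g) h + u * jac \<chi> (u * jac \<chi> g h) f + u * jac \<chi> (u * jac \<chi> h f) g = 0"
  using jac_jacobi[of \<chi> f g h] jac_plucker[of \<chi> f g u h] unfolding jac_mult by algebra

end

interpretation pdiff: commuting_derivations "pdiff :: 3 \<Rightarrow> 'f::field_char_0 poly3 \<Rightarrow> 'f poly3"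
  by unfold_locales (rule pdiff_add pdiff_mult pdiff_commute)+

definition fps_pdiff :: "3 \<Rightarrow> 'f::field_char_0 poly3 fps \<Rightarrow> 'f poly3 fps" where
  "fps_pdiff i F = Abs_fps (\<lambda>n. pdiff i (fps_nth F n))"

lemma fps_nth_pdiff: "fps_nth (fps_pdiff i F) n = pdiff i (fps_nth F n)"
  by (simp add: fps_pdiff_def)

interpretation fps_pdiff: commuting_derivations "fps_pdiff :: 3 \<Rightarrow> 'f::field_char_0 poly3 fps \<Rightarrow> _"
proof
  fix i j :: 3 and F G :: "'f poly3 fps"
  show "fps_pdiff i (F + G) = fps_pdiff i F + fps_pdiff i G"
    by (simp add: fps_eq_iff fps_nth_pdiff pdiff_add)
  show "fps_pdiff i (fps_pdiff j F) = fps_pdiff j (fps_pdiff i F)"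
    by (simp add: fps_eq_iff fps_nth_pdiff pdiff_commute)
  show "fps_pdiff i (F * G) = F * fps_pdiff i G + G * fps_pdiff i F"
    unfolding mult.commute[of G]
    by (simp only: fps_eq_iff fps_nth_pdiff fps_mult_nth pdiff_sum pdiff_mult fps_add_nth sum.distrib
        mult.commute[of "fps_nth G _"] simp_thms)
qed

section \<open>Multiderivations in coordinates\<close>

interpretation cochain: vector_space "cscale :: 'f::field_char_0 \<Rightarrow> 'f cochain \<Rightarrow> 'f cochain"
  by unfold_locales
    (simp_all add: cscale_def fun_eq_iff smult3_add smult3_smult3 smult3_one poly3.scale_left_distrib)

lemma multiderivationsD:
  assumes "P \<in> multiderivations k"
  shows "length xs \<noteq> k \<Longrightarrow> P xs = 0"
    and "P (xs @ (f + g) # ys) = P (xs @ f # ys) + P (xs @ g # ys)"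
    and "P (xs @ smult3 c f # ys) = smult3 c (P (xs @ f # ys))"
    and "P (xs @ (f * g) # ys) = f * P (xs @ g # ys) + g * P (xs @ f # ys)"
    and "P (xs @ f # g # ys) = - P (xs @ g # f # ys)"
  using assms unfolding multiderivations_def by blast+

lemma multiderivation_Cons:
  assumes "P \<in> multiderivations k"
  shows "P ((f + g) # ys) = P (f # ys) + P (g # ys)"
    and "P (smult3 c f # ys) = smult3 c (P (f # ys))"
    and "P ((f * g) # ys) = f * P (g # ys) + g * P (f # ys)"
    and "P (- f # ys) = - P (f # ys)"
proof -
  show "P ((f + g) # ys) = P (f # ys) + P (g # ys)" for f g
    using multiderivationsD(2)[OF assms, of "[]"] by simp
  show s: "P (smult3 c f # ys) = smult3 c (P (f # ys))" for c f
    using multiderivationsD(3)[OF assms, of "[]"] by simp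
  show "P ((f * g) # ys) = f * P (g # ys) + g * P (f # ys)"
    using multiderivationsD(4)[OF assms, of "[]"] by simp
  show "P (- f # ys) = - P (f # ys)"
    using s[of "- 1" f] by (simp add: smult3_def single_uminus)
qed

lemma biderivation_skew: "P \<in> multiderivations 2 \<Longrightarrow> P [f, g] = - P [g, f]"
  using multiderivationsD(5)[of P 2 "[]" f g "[]"] by simp

lemma multiderivations_subspace: "cochain.subspace (multiderivations k)"
  unfolding cochain.subspace_def
proof (intro conjI ballI allI)
  show "0 \<in> multiderivations k" by (simp add: multiderivations_def smult3_def)
next
  fix P Q :: "'a cochain" assume P: "P \<in> multiderivations k" and Q: "Q \<in> multiderivations k"
  show "P + Q \<in> multiderivations k"
    unfolding multiderivations_def mem_Collect_eq
  proof (intro conjI allI impI)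
    show "(P + Q) (xs @ f # g # ys) = - (P + Q) (xs @ g # f # ys)" for xs ys f g
      using multiderivationsD(5)[OF P, of xs f g ys] multiderivationsD(5)[OF Q, of xs f g ys] by simp
  qed (simp_all add: multiderivationsD(1-4)[OF P] multiderivationsD(1-4)[OF Q] smult3_add algebra_simps)
next
  fix c and P :: "'a cochain" assume P: "P \<in> multiderivations k"
  show "cscale c P \<in> multiderivations k"
    unfolding multiderivations_def mem_Collect_eq cscale_def
  proof (intro conjI allI impI)
    show "smult3 c (P (xs @ f # g # ys)) = - smult3 c (P (xs @ g # f # ys))" for xs ys f g
      using multiderivationsD(5)[OF P, of xs f g ys] by simp
  qed (simp_all add: multiderivationsD(1-4)[OF P] smult3_add smult3_mult smult3_smult3 mult.commute)
qed

lemma coboundary_op_add: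
  assumes "\<pi> \<in> multiderivations l"
  shows "coboundary_op \<pi> k (P + Q) = coboundary_op \<pi> k P + coboundary_op \<pi> k Q"
  by (rule ext) (simp add: coboundary_op_def schouten_def insertion_def multiderivation_Cons[OF assms]
      sum.distrib distrib_left algebra_simps)

lemma coboundary_op_scale:
  assumes "\<pi> \<in> multiderivations l"
  shows "coboundary_op \<pi> k (cscale c P) = cscale c (coboundary_op \<pi> k P)"
  by (rule ext) (simp add: coboundary_op_def schouten_def insertion_def multiderivation_Cons[OF assms]
      cscale_def smult3_mult poly3.scale_right_diff_distrib flip: poly3.scale_sum_right)

lemma coboundaries_subspace:
  assumes "\<pi> \<in> multiderivations l"
  shows "cochain.subspace (coboundaries \<pi> k)"
proof (cases "k = 0")
  case True
  then show ?thesis by (simp add: coboundaries_def)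
next
  case False
  let ?d = "coboundary_op \<pi> (k - 1)" and ?M = "multiderivations (k - 1)"
  note M = multiderivations_subspace[of "k - 1"]
  have "0 \<in> ?d ` ?M"
  proof
    show "0 \<in> ?M" by (rule cochain.subspace_0[OF M])
    show "0 = ?d 0"
      using coboundary_op_add[OF assms, of "k - 1" 0 0] by simp
  qed
  moreover have "P + Q \<in> ?d ` ?M" if "P \<in> ?d ` ?M" "Q \<in> ?d ` ?M" for P Q
  proof -
    from that obtain p q where pq: "p \<in> ?M" "q \<in> ?M" "P = ?d p" "Q = ?d q" by blast
    have "P + Q = ?d (p + q)" unfolding pq by (rule coboundary_op_add[OF assms, symmetric])
    then show ?thesis using cochain.subspace_add[OF M pq(1,2)] by (simp only: imageI)
  qed
  moreover have "cscale c P \<in> ?d ` ?M" if "P \<in> ?d ` ?M" for c P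
  proof -
    from that obtain p where p: "p \<in> ?M" "P = ?d p" by blast
    have "cscale c P = ?d (cscale c p)" unfolding p by (rule coboundary_op_scale[OF assms, symmetric])
    then show ?thesis using cochain.subspace_scale[OF M p(1)] by (simp only: imageI)
  qed
  ultimately show ?thesis
    using False unfolding cochain.subspace_def coboundaries_def by simp
qed

lemma derivation_coordinates:
  fixes D :: "'f::field_char_0 poly3 \<Rightarrow> 'f poly3"
  assumes add: "\<And>f g. D (f + g) = D f + D g" and mult: "\<And>f g. D (f * g) = f * D g + g * D f"
    and scale: "\<And>c f. D (smult3 c f) = smult3 c (D f)"
  shows "D p = D (Var 0) * pdiff 0 p + D (Var 1) * pdiff 1 p + D (Var 2) * pdiff 2 p"
proof -
  define E where "E p = D (Var 0) * pdiff 0 p + D (Var 1) * pdiff 1 p + D (Var 2) * pdiff 2 p" for p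
  have E: "E (f + g) = E f + E g" "E (f * g) = f * E g + g * E f" "E (smult3 c f) = smult3 c (E f)"
    for f g c
    by (simp_all add: E_def pdiff_add pdiff_mult pdiff_smult3 smult3_add smult3_mult algebra_simps)
  have one: "D 1 = 0" "E 1 = 0"
    using mult[of 1 1] E(2)[of 1 1] by simp_all
  have var: "D (Var i) = E (Var i)" for i
    using cases_3[of i] by (auto simp: E_def pdiff_Var)
  have "D (Var i ^ n) = E (Var i ^ n)" for i n
    by (induction n) (simp_all add: one mult E var)
  then have mono: "D (Poly_Mapping.single m 1) = E (Poly_Mapping.single m 1)" for m
  proof (induction m rule: pm_induct)
    case (add m n)
    then show ?case using mult E(2) by (metis mult_single mult_1)
  qed (simp add: Var_power)
  have "D p = E p"
  proof (induction p rule: pm_induct)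
    case (single m c)
    have "Poly_Mapping.single m c = smult3 c (Poly_Mapping.single m 1)"
      by (simp add: smult3_def mult_single)
    then show ?case by (simp add: scale E mono)
  qed (simp add: add E)
  then show ?thesis by (simp add: E_def)
qed

text \<open>The coordinates \<open>a\<close>, \<open>b\<close>, \<open>c\<close> are the values on
  \<open>(y, z)\<close>, \<open>(z, x)\<close>, \<open>(x, y)\<close>; this cyclic order makes
  gradients correspond to Jacobian brackets.\<close>

definition bivector :: "'f::field_char_0 poly3 \<Rightarrow> 'f poly3 \<Rightarrow> 'f poly3 \<Rightarrow> 'f cochain" where
  "bivector a b c xs = (if length xs = 2 then let f = xs ! 0; g = xs ! 1 in
      c * (pdiff 0 f * pdiff 1 g - pdiff 1 f * pdiff 0 g)
    + a * (pdiff 1 f * pdiff 2 g - pdiff 2 f * pdiff 1 g)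
    + b * (pdiff 2 f * pdiff 0 g - pdiff 0 f * pdiff 2 g) else 0)"

lemma bivector_pair: "bivector a b c [f, g] =
      c * (pdiff 0 f * pdiff 1 g - pdiff 1 f * pdiff 0 g)
    + a * (pdiff 1 f * pdiff 2 g - pdiff 2 f * pdiff 1 g)
    + b * (pdiff 2 f * pdiff 0 g - pdiff 0 f * pdiff 2 g)"
  by (simp add: bivector_def)

lemma bivector_jacobian: "jacobian_bracket \<phi> = bivector (pdiff 0 \<phi>) (pdiff 1 \<phi>) (pdiff 2 \<phi>)"
  by (rule ext) (simp add: jacobian_bracket_def bivector_def)

lemma bivector_multiderivation: "bivector a b c \<in> multiderivations 2"
proof -
  have z: "length xs \<noteq> 2 \<Longrightarrow> bivector a b c xs = 0" for xs
    by (simp add: bivector_def)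
  have pair: "(\<exists>g. xs = [] \<and> ys = [g]) \<or> (\<exists>g. xs = [g] \<and> ys = []) \<or> length xs + length ys \<noteq> 1"
    for xs ys :: "'a poly3 list"
    by (cases xs; cases ys) auto
  have "bivector a b c (xs @ (f + g) # ys) = bivector a b c (xs @ f # ys) + bivector a b c (xs @ g # ys)"
    "bivector a b c (xs @ smult3 e f # ys) = smult3 e (bivector a b c (xs @ f # ys))"
    "bivector a b c (xs @ (f * g) # ys) = f * bivector a b c (xs @ g # ys) + g * bivector a b c (xs @ f # ys)"
    for xs ys f g e
    using pair[of xs ys]
    by (auto simp: z bivector_pair pdiff_add pdiff_mult pdiff_smult3 smult3_mult smult3_add
        poly3.scale_right_diff_distrib algebra_simps)
  moreover have "bivector a b c (xs @ f # g # ys) = - bivector a b c (xs @ g # f # ys)" for xs ys f g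
    by (cases "xs = [] \<and> ys = []") (auto simp: z bivector_pair algebra_simps)
  ultimately show ?thesis
    using z unfolding multiderivations_def by blast
qed

lemma bivector_add: "bivector a b c + bivector a' b' c' = bivector (a + a') (b + b') (c + c')"
  by (rule ext) (simp add: bivector_def Let_def algebra_simps)

lemma bivector_scale: "cscale r (bivector a b c) = bivector (smult3 r a) (smult3 r b) (smult3 r c)"
  by (rule ext) (simp add: cscale_def bivector_def Let_def smult3_add smult3_mult)

lemma bivector_0: "bivector 0 0 0 = 0"
  by (rule ext) (simp add: bivector_def)

lemma biderivation_coordinates:
  assumes "P \<in> multiderivations 2"
  shows "P = bivector (P [Var 1, Var 2]) (P [Var 2, Var 0]) (P [Var 0, Var 1])"
  by (rule biderivation_eq[OF assms bivector_multiderivation]) (simp_all add: bivector_pair pdiff_Var)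

lemma conformal_poisson_structure:
  "poisson_structure (bivector (u * pdiff 0 \<chi>) (u * pdiff 1 \<chi>) (u * pdiff 2 \<chi>))"
proof -
  have "bivector (u * pdiff 0 \<chi>) (u * pdiff 1 \<chi>) (u * pdiff 2 \<chi>) [f, g] = u * pdiff.jac \<chi> f g" for f g
    by (simp add: bivector_pair pdiff.jac_def algebra_simps)
  then show ?thesis
    by (simp add: poisson_structure_def bivector_multiderivation pdiff.conformal_jacobi)
qed

text \<open>Up to sign, these are the mixed terms in the Jacobi expression of
  \<open>\<pi> + P\<close>. The shuffle \<open>{0, 2}\<close> has sign -1, which skew-symmetry
  absorbs into the cyclic form.\<close>

lemma coboundary_op_2:
  assumes P: "P \<in> multiderivations 2" and \<pi>: "\<pi> \<in> multiderivations 2"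
  shows "coboundary_op \<pi> 2 P [f, g, h] =
    - (P [\<pi> [f, g], h] + P [\<pi> [g, h], f] + P [\<pi> [h, f], g]
      + (\<pi> [P [f, g], h] + \<pi> [P [g, h], f] + \<pi> [P [h, f], g]))"
proof -
  have subsets: "{S. S \<subseteq> {..<3::nat} \<and> card S = 2} = {{0, 1}, {0, 2}, {1, 2}}"
  proof (intro equalityI subsetI)
    fix S assume "S \<in> {S. S \<subseteq> {..<3::nat} \<and> card S = 2}"
    then obtain a b where "S = {a, b}" "a \<noteq> b" "a < 3" "b < 3"
      by (auto simp: card_2_iff)
    then show "S \<in> {{0, 1}, {0, 2}, {1, 2}}"
      by (auto simp: less_Suc_eq numeral_3_eq_3 numeral_2_eq_2)
  qed auto
  have inv: "{(i, j). i \<in> {0, 1::nat} \<and> j \<in> {..<3} - {0, 1::nat} \<and> j < i} = {}"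
    "{(i, j). i \<in> {0, 2::nat} \<and> j \<in> {..<3} - {0, 2} \<and> j < i} = {(2, 1::nat)}"
    "{(i, j). i \<in> {1, 2} \<and> j \<in> {..<3} - {1, 2} \<and> j < i} = {(1, 0), (2, 0::nat)}"
    by auto
  have sign: "shuffle_sign 3 {0, 1} = (1 :: 'a poly3)" "shuffle_sign 3 {0, 2} = (- 1 :: 'a poly3)"
    "shuffle_sign 3 {1, 2} = (1 :: 'a poly3)"
    unfolding shuffle_sign_def inv by simp_all
  have len: "length [f, g, h] = 3" by simp
  have sum: "(\<Sum>S\<in>{{0, 1}, {0, 2}, {1, 2}}. F S) = F {0, 1} + F {0, 2} + F {1, 2}"
    for F :: "nat set \<Rightarrow> 'a poly3"
    by (simp add: doubleton_eq_iff add.assoc)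
  have ins: "insertion 2 Q R [f, g, h] = Q [R [f, g], h] + Q [R [g, h], f] + Q [R [h, f], g]"
    if "Q \<in> multiderivations 2" "R \<in> multiderivations 2" for Q R
  proof -
    have "insertion 2 Q R [f, g, h] = Q [R [f, g], h] - Q [R [f, h], g] + Q [R [g, h], f]"
      unfolding insertion_def len subsets sum sign by (simp add: nths_Cons)
    also have "Q [R [f, h], g] = - Q [R [h, f], g]"
      using biderivation_skew[OF that(2), of f h] multiderivation_Cons(4)[OF that(1)] by simp
    finally show ?thesis by simp
  qed
  show ?thesis
    by (simp add: coboundary_op_def schouten_def ins[OF P \<pi>] ins[OF \<pi> P])
qed

lemma coboundary_op_length:
  "length xs \<noteq> Suc k \<Longrightarrow> coboundary_op \<pi> k P xs = 0"
  by (simp add: coboundary_op_def schouten_def)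

text \<open>The Jacobi expression is quadratic in the bracket and the coboundary is, up to sign, its
  polarisation, so it vanishes when all three Jacobi expressions do.\<close>

lemma cocycle_polarise:
  assumes \<pi>: "poisson_structure \<pi>" and P: "poisson_structure P" and "poisson_structure (\<pi> + P)"
  shows "P \<in> cocycles \<pi> 2"
proof -
  have md: "P \<in> multiderivations 2" "\<pi> \<in> multiderivations 2"
    using assms by (auto simp: poisson_structure_def)
  have "coboundary_op \<pi> 2 P xs = 0" for xs
  proof (cases "length xs = 3")
    case True
    then obtain f g h where xs: "xs = [f, g, h]"
      by (auto simp: length_Suc_conv numeral_3_eq_3)
    have J: "R [R [f, g], h] + R [R [g, h], f] + R [R [h, f], g] = 0" if "poisson_structure R" for R
      using that by (simp add: poisson_structure_def)
    let ?S = "\<pi> + P"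
    have "coboundary_op \<pi> 2 P xs = (P [P [f, g], h] + P [P [g, h], f] + P [P [h, f], g])
      + (\<pi> [\<pi> [f, g], h] + \<pi> [\<pi> [g, h], f] + \<pi> [\<pi> [h, f], g])
      - (?S [?S [f, g], h] + ?S [?S [g, h], f] + ?S [?S [h, f], g])"
      unfolding xs coboundary_op_2[OF md]
      by (simp add: multiderivation_Cons[OF md(1)] multiderivation_Cons[OF md(2)])
    then show ?thesis by (simp only: J assms) simp
  qed (simp add: coboundary_op_length)
  then show ?thesis using md by (simp add: cocycles_def fun_eq_iff)
qed

section \<open>Cosets and bases of quotient spaces\<close>

lemma elt_set_plus_eq_iff:
  assumes "module.subspace scale (B :: 'v::ab_group_add set)" and "module scale"
  shows "x +o B = y +o B \<longleftrightarrow> x - y \<in> B"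
proof -
  interpret module scale by fact
  note B = assms(1)
  show ?thesis
  proof
    assume "x +o B = y +o B"
    then have "x \<in> y +o B"
      using subspace_0[OF B] by (force simp: elt_set_plus_def)
    then show "x - y \<in> B" by (auto simp: elt_set_plus_def)
  next
    assume xy: "x - y \<in> B"
    have sub: "x +o B \<subseteq> y +o B" if "x - y \<in> B" for x y
    proof
      fix v assume "v \<in> x +o B"
      then obtain b where b: "b \<in> B" "v = x + b" by (auto simp: elt_set_plus_def)
      then have "v = y + ((x - y) + b)" "(x - y) + b \<in> B"
        using subspace_add[OF B that b(1)] by simp_all
      then show "v \<in> y +o B" unfolding elt_set_plus_def by blast
    qed
    have "y - x \<in> B" using subspace_neg[OF B xy] by simp
    then show "x +o B = y +o B" using sub xy by blast
  qed
qed

context vector_space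
begin

text \<open>
  Keep the members of the spanning sequence that are not combinations of earlier ones modulo \<open>B\<close>.
\<close>

lemma ex_classes_basis_subsequence:
  fixes s :: "nat \<Rightarrow> 'b"
  assumes B: "subspace B" and sV: "range s \<subseteq> V" and span: "V \<subseteq> span (range s)"
  shows "\<exists>K. classes_basis scale V B K s"
proof -
  define K where "K = {n. s n \<notin> span (s ` {..<n} \<union> B)}"
  have B0: "x +o B = B \<longleftrightarrow> x \<in> B" for x
    using elt_set_plus_eq_iff[OF B module_axioms, of x 0] by (simp add: elt_set_plus_def)
  have indep: "\<forall>k\<in>K. c k = 0"
    if fin: "finite {k \<in> K. c k \<noteq> 0}" and "lincomb scale K c s +o B = B" for c
  proof (rule ccontr)
    assume "\<not> ?thesis"
    then have ne: "{k \<in> K. c k \<noteq> 0} \<noteq> {}" by blast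
    let ?A = "{k \<in> K. c k \<noteq> 0}"
    \<comment> \<open>Solving the relation for its last term puts \<open>s k\<close> in the span of
      earlier members and \<open>B\<close>, against the choice of \<open>K\<close>.\<close>
    define k where "k = Max ?A"
    have k: "k \<in> K" "c k \<noteq> 0" using Max_in[OF fin ne] by (auto simp: k_def)
    let ?S = "s ` {..<k} \<union> B"
    have "(\<Sum>j\<in>?A. scale (c j) (s j)) \<in> span ?S"
      using that(2) unfolding B0 lincomb_def by (intro span_base UnI2)
    moreover have "(\<Sum>j\<in>?A - {k}. scale (c j) (s j)) \<in> span ?S"
    proof (intro span_sum span_scale span_base)
      fix j assume "j \<in> ?A - {k}"
      then have "j < k" using Max_ge[OF fin, of j] unfolding k_def by auto
      then show "s j \<in> ?S" by blast
    qed
    ultimately have "(\<Sum>j\<in>?A. scale (c j) (s j)) - (\<Sum>j\<in>?A - {k}. scale (c j) (s j)) \<in> span ?S"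
      by (rule span_diff)
    also have "(\<Sum>j\<in>?A. scale (c j) (s j)) - (\<Sum>j\<in>?A - {k}. scale (c j) (s j)) = scale (c k) (s k)"
      using sum.remove[OF fin, of k "\<lambda>j. scale (c j) (s j)"] k by simp
    finally have "scale (c k) (s k) \<in> span ?S" .
    then have "scale (inverse (c k)) (scale (c k) (s k)) \<in> span ?S"
      by (rule span_scale)
    then show False using k by (simp add: K_def)
  qed
  have "s n \<in> span (s ` K \<union> B)" for n
  proof (induction n rule: less_induct)
    case (less n)
    show ?case
    proof (cases "n \<in> K")
      case False
      then have "s n \<in> span (s ` {..<n} \<union> B)" by (simp add: K_def)
      also have "\<dots> \<subseteq> span (s ` K \<union> B)"
        using less by (intro span_minimal) (auto intro: span_base)
      finally show ?thesis .
    qed (auto intro: span_base)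
  qed
  then have "span (range s) \<subseteq> span (s ` K \<union> B)"
    by (intro span_minimal) auto
  then have VK: "V \<subseteq> span (s ` K \<union> B)" using span by blast
  have "\<exists>c. finite {k \<in> K. c k \<noteq> 0} \<and> v +o B = lincomb scale K c s +o B" if "v \<in> V" for v
  proof -
    have "v \<in> span (s ` K \<union> B)" using that VK by blast
    moreover have "span B = B" using B by simp
    ultimately obtain x b where x: "v = x + b" "x \<in> span (s ` K)" "b \<in> B"
      unfolding span_Un by auto
    then obtain t r where t: "finite t" "t \<subseteq> s ` K" "x = (\<Sum>a\<in>t. scale (r a) a)"
      by (auto simp: span_explicit)
    \<comment> \<open>The span is that of a set, whereas coefficients are indexed; \<open>L\<close>
      picks one index for each vector, since \<open>s\<close> may repeat values.\<close>
    then obtain L where L: "L \<subseteq> K" "inj_on s L" "t = s ` L"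
      by (auto simp: subset_image_inj)
    then have finL: "finite L" using t(1) finite_imageD by blast
    define c where "c = (\<lambda>k. if k \<in> L then r (s k) else 0)"
    have "x = (\<Sum>k\<in>L. scale (c k) (s k))"
      unfolding t(3) L(3) by (simp add: sum.reindex[OF L(2)] c_def)
    also have "\<dots> = lincomb scale K c s"
      unfolding lincomb_def
      by (rule sum.mono_neutral_right) (use finL L(1) in \<open>auto simp: c_def split: if_splits\<close>)
    finally have "v - lincomb scale K c s \<in> B" using x by simp
    moreover have "finite {k \<in> K. c k \<noteq> 0}"
      by (rule finite_subset[OF _ finL]) (auto simp: c_def)
    ultimately show ?thesis
      using elt_set_plus_eq_iff[OF B module_axioms] by blast
  qed
  then have "classes_basis scale V B K s"
    unfolding classes_basis_def classes_def using sV indep by blast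
  then show ?thesis ..
qed

end

lemma countable_exponents: "countable (UNIV :: (3 \<Rightarrow>\<^sub>0 nat) set)"
proof (rule countableI')
  show "inj (\<lambda>m :: 3 \<Rightarrow>\<^sub>0 nat. (coef m 0, coef m 1, coef m 2))"
  proof (rule injI)
    fix m n :: "3 \<Rightarrow>\<^sub>0 nat"
    assume "(coef m 0, coef m 1, coef m 2) = (coef n 0, coef n 1, coef n 2)"
    then have "coef m i = coef n i" for i
      using cases_3[of i] by auto
    then show "m = n" by (rule poly_mapping_eqI)
  qed
qed

section \<open>The second cohomology and the deformations\<close>

text \<open>The field \<open>grad h + g grad phi\<close>, as a linear function of the pair
  \<open>(h, g)\<close>, so that combinations of such cocycles are combinations of pairs.\<close>

definition special_bivector :: "'f::field_char_0 poly3 \<Rightarrow> 'f poly3 \<times> 'f poly3 \<Rightarrow> 'f cochain" where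
  "special_bivector \<phi> p = bivector (pdiff 0 (fst p) + snd p * pdiff 0 \<phi>)
     (pdiff 1 (fst p) + snd p * pdiff 1 \<phi>) (pdiff 2 (fst p) + snd p * pdiff 2 \<phi>)"

lemma special_bivector_add:
  "special_bivector \<phi> (h + h', g + g') = special_bivector \<phi> (h, g) + special_bivector \<phi> (h', g')"
  by (simp add: special_bivector_def bivector_add pdiff_add algebra_simps)

lemma special_bivector_scale:
  "special_bivector \<phi> (smult3 c h, smult3 c g) = cscale c (special_bivector \<phi> (h, g))"
  by (simp add: special_bivector_def bivector_scale pdiff_smult3 smult3_add smult3_mult)

lemma special_bivector_sum:
  "special_bivector \<phi> (\<Sum>k\<in>A. smult3 (c k) (h k), \<Sum>k\<in>A. smult3 (c k) (g k))
    = (\<Sum>k\<in>A. cscale (c k) (special_bivector \<phi> (h k, g k)))"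
  by (induction A rule: infinite_finite_induct)
    (simp_all add: special_bivector_add special_bivector_scale,
     simp_all add: special_bivector_def pdiff_0 bivector_0)

lemma special_bivector_span:
  assumes "\<And>m. special_bivector \<phi> (Poly_Mapping.single m 1, 0) \<in> cochain.span S"
    and "\<And>m. special_bivector \<phi> (0, Poly_Mapping.single m 1) \<in> cochain.span S"
  shows "special_bivector \<phi> (h, g) \<in> cochain.span S"
proof -
  have single_eq: "Poly_Mapping.single m c = smult3 c (Poly_Mapping.single m 1)" for m and c :: 'a
    by (simp add: smult3_def mult_single)
  have sum: "special_bivector \<phi> (h + h', g + g') \<in> cochain.span S"
    if "special_bivector \<phi> (h, g) \<in> cochain.span S" "special_bivector \<phi> (h', g') \<in> cochain.span S"
    for h g h' g'
    unfolding special_bivector_add using that by (rule cochain.span_add)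
  have "special_bivector \<phi> (h, 0) \<in> cochain.span S"
  proof (induction h rule: pm_induct)
    case (single m c)
    show ?case
      using cochain.span_scale[OF assms(1), of c m] special_bivector_scale[of \<phi> c "Poly_Mapping.single m 1" 0]
      by (simp add: single_eq[of m c])
  next
    case (add p q)
    then show ?case
      using sum[of p 0 q 0] by simp
  qed
  moreover have "special_bivector \<phi> (0, g) \<in> cochain.span S"
  proof (induction g rule: pm_induct)
    case (single m c)
    show ?case
      using cochain.span_scale[OF assms(2), of c m] special_bivector_scale[of \<phi> c 0 "Poly_Mapping.single m 1"]
      by (simp add: single_eq[of m c])
  next
    case (add p q)
    then show ?case
      using sum[of 0 p 0 q] by simp
  qed
  ultimately show ?thesis
    using sum[of h 0 0 g] by simp
qed

text \<open>Each summand separately keeps the sum with \<open>grad phi\<close> conformal: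
  \<open>grad (phi + h)\<close> and \<open>(1 + g) grad phi\<close> both give Poisson
  structures.\<close>

lemma special_bivector_cocycle:
  "special_bivector \<phi> (h, 0) \<in> cocycles (jacobian_bracket \<phi>) 2"
  "special_bivector \<phi> (0, g) \<in> cocycles (jacobian_bracket \<phi>) 2"
proof -
  let ?b = "\<lambda>u \<chi>. bivector (u * pdiff 0 \<chi>) (u * pdiff 1 \<chi>) (u * pdiff 2 \<chi>)"
  have J: "jacobian_bracket \<phi> = ?b 1 \<phi>"
    by (simp add: bivector_jacobian)
  have 1: "special_bivector \<phi> (h, 0) = ?b 1 h" "special_bivector \<phi> (0, g) = ?b g \<phi>"
    by (simp_all add: special_bivector_def pdiff_0)
  have 2: "?b 1 \<phi> + ?b 1 h = ?b 1 (\<phi> + h)" "?b 1 \<phi> + ?b g \<phi> = ?b (1 + g) \<phi>"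
    by (simp_all add: bivector_add pdiff_add distrib_right)
  show "special_bivector \<phi> (h, 0) \<in> cocycles (jacobian_bracket \<phi>) 2"
    unfolding J 1 by (rule cocycle_polarise; (unfold 2)?; rule conformal_poisson_structure)
  show "special_bivector \<phi> (0, g) \<in> cocycles (jacobian_bracket \<phi>) 2"
    unfolding J 1 by (rule cocycle_polarise; (unfold 2)?; rule conformal_poisson_structure)
qed

text \<open>The value of the coboundary on the three variables is, up to sign,
  \<open>grad phi . curl W\<close>.\<close>

lemma cocycle_2_coordinates:
  assumes "P \<in> cocycles (jacobian_bracket \<phi>) 2"
  obtains a b c where "P = bivector a b c"
    and "pdiff 0 \<phi> * (pdiff 1 c - pdiff 2 b) + pdiff 1 \<phi> * (pdiff 2 a - pdiff 0 c)
      + pdiff 2 \<phi> * (pdiff 0 b - pdiff 1 a) = 0"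
proof -
  have P: "P \<in> multiderivations 2" "coboundary_op (jacobian_bracket \<phi>) 2 P = 0"
    using assms by (simp_all add: cocycles_def)
  obtain a b c where abc: "P = bivector a b c"
    using biderivation_coordinates[OF P(1)] by blast
  have "coboundary_op (jacobian_bracket \<phi>) 2 P [Var 0, Var 1, Var 2] = 0"
    by (simp add: P(2))
  then have "pdiff 0 \<phi> * (pdiff 1 c - pdiff 2 b) + pdiff 1 \<phi> * (pdiff 2 a - pdiff 0 c)
      + pdiff 2 \<phi> * (pdiff 0 b - pdiff 1 a) = 0"
    unfolding coboundary_op_2[OF P(1) jacobian_bracket_multiderivation]
    unfolding abc bivector_jacobian
    by (simp add: bivector_pair pdiff_Var pdiff_add pdiff_diff pdiff_mult pdiff_0
        pdiff_commute[of 1 0] pdiff_commute[of 2 0] pdiff_commute[of 2 1] algebra_simps)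
  then show ?thesis using that abc by blast
qed

definition conformal_coeff :: "(nat \<Rightarrow> 'f::field_char_0 poly3) \<Rightarrow> (nat \<Rightarrow> 'f poly3) \<Rightarrow> nat \<Rightarrow> 'f cochain" where
  "conformal_coeff u \<chi> n = bivector (\<Sum>i\<le>n. u i * pdiff 0 (\<chi> (n - i)))
     (\<Sum>i\<le>n. u i * pdiff 1 (\<chi> (n - i))) (\<Sum>i\<le>n. u i * pdiff 2 (\<chi> (n - i)))"

text \<open>
  The coefficients are those of \<open>u \<nabla>\<chi>\<close> for power series \<open>u\<close>, \<open>\<chi>\<close> in \<open>\<nu>\<close>, so the Jacobi identity
  holds for the extended bracket over the power series ring.
\<close>

lemma conformal_formal_deformation:
  "formal_deformation (conformal_coeff u \<chi> 0) (conformal_coeff u \<chi>)"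
proof -
  let ?u = "Abs_fps u" and ?x = "Abs_fps \<chi>"
  have "extend_bracket (conformal_coeff u \<chi>) F G = ?u * fps_pdiff.jac ?x F G" for F G
  proof (rule fps_ext)
    fix n
    have prod: "fps_nth (A * (B * C)) n
      = (\<Sum>i\<le>n. \<Sum>j\<le>n - i. fps_nth A i * (fps_nth B j * fps_nth C (n - i - j)))"
      for A B C :: "'a poly3 fps"
      by (simp add: fps_mult_nth sum_distrib_left atMost_atLeast0)
    have "?u * fps_pdiff.jac ?x F G =
        (?u * fps_pdiff 2 ?x) * (fps_pdiff 0 F * fps_pdiff 1 G)
      - (?u * fps_pdiff 2 ?x) * (fps_pdiff 1 F * fps_pdiff 0 G)
      + ((?u * fps_pdiff 0 ?x) * (fps_pdiff 1 F * fps_pdiff 2 G)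
      - (?u * fps_pdiff 0 ?x) * (fps_pdiff 2 F * fps_pdiff 1 G))
      + ((?u * fps_pdiff 1 ?x) * (fps_pdiff 2 F * fps_pdiff 0 G)
      - (?u * fps_pdiff 1 ?x) * (fps_pdiff 0 F * fps_pdiff 2 G))"
      unfolding fps_pdiff.jac_def by (simp add: algebra_simps)
    moreover have "fps_nth (?u * fps_pdiff i ?x) k = (\<Sum>j\<le>k. u j * pdiff i (\<chi> (k - j)))" for i k
      by (simp add: fps_mult_nth fps_nth_pdiff atMost_atLeast0)
    ultimately show "fps_nth (extend_bracket (conformal_coeff u \<chi>) F G) n
      = fps_nth (?u * fps_pdiff.jac ?x F G) n"
      by (simp add: extend_bracket_def conformal_coeff_def bivector_pair prod fps_nth_pdiff
          sum.distrib sum_subtractf right_diff_distrib)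
  qed
  then show ?thesis
    by (simp add: formal_deformation_def conformal_coeff_def bivector_multiderivation
        fps_pdiff.conformal_jacobi)
qed

lemma (in isolated_quasihomogeneous) cocycle_2_special:
  assumes "P \<in> cocycles (jacobian_bracket \<phi>) 2"
  shows "\<exists>h g. P = special_bivector \<phi> (h, g)"
proof -
  obtain a b c where P: "P = bivector a b c"
    and "pdiff 0 \<phi> * (pdiff 1 c - pdiff 2 b) + pdiff 1 \<phi> * (pdiff 2 a - pdiff 0 c)
      + pdiff 2 \<phi> * (pdiff 0 b - pdiff 1 a) = 0"
    using assms by (rule cocycle_2_coordinates)
  then show ?thesis
    using cocycle_decomposition by (simp add: special_bivector_def) metis
qed

lemma (in isolated_quasihomogeneous) cocycle_1_coboundary:
  assumes ne: "d \<noteq> w 0 + w 1 + w 2" and P: "P \<in> cocycles (jacobian_bracket \<phi>) 1"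
  shows "P \<in> coboundaries (jacobian_bracket \<phi>) 1"
proof -
  have md: "P \<in> multiderivations 1" and cob: "coboundary_op (jacobian_bracket \<phi>) 1 P = 0"
    using P by (simp_all add: cocycles_def)
  define a b c where "a = P [Var 0]" and "b = P [Var 1]" and "c = P [Var 2]"
  have Pf: "P [f] = a * pdiff 0 f + b * pdiff 1 f + c * pdiff 2 f" for f
    unfolding a_def b_def c_def
    by (rule derivation_coordinates) (simp_all add: multiderivation_Cons[OF md])
  have "jacobian_bracket \<phi> [P [f], g] - jacobian_bracket \<phi> [P [g], f] - P [jacobian_bracket \<phi> [f, g]] = 0"
    for f g
    using cob by (simp flip: coboundary_op_1)
  \<comment> \<open>On these pairs the cocycle condition gives the \<open>z\<close>,
    \<open>x\<close> and \<open>y\<close> components of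
    \<open>g grad phi - grad f = 0\<close>.\<close>
  from this[of "Var 0" "Var 1"] this[of "Var 1" "Var 2"] this[of "Var 2" "Var 0"]
  have "\<exists>h. a = pdiff 1 \<phi> * pdiff 2 h - pdiff 2 \<phi> * pdiff 1 h
    \<and> b = pdiff 2 \<phi> * pdiff 0 h - pdiff 0 \<phi> * pdiff 2 h \<and> c = pdiff 0 \<phi> * pdiff 1 h - pdiff 1 \<phi> * pdiff 0 h"
    by (intro cocycle_1_exact[OF ne refl refl])
      (simp_all add: Pf jacobian_bracket_pair pdiff_Var pdiff_add pdiff_mult
        pdiff_commute[of 1 0] pdiff_commute[of 2 0] pdiff_commute[of 2 1] algebra_simps)
  then obtain h where h: "a = pdiff 1 \<phi> * pdiff 2 h - pdiff 2 \<phi> * pdiff 1 h"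
    "b = pdiff 2 \<phi> * pdiff 0 h - pdiff 0 \<phi> * pdiff 2 h" "c = pdiff 0 \<phi> * pdiff 1 h - pdiff 1 \<phi> * pdiff 0 h"
    by blast
  \<comment> \<open>The sign cancels the one in \<open>coboundary_op_0\<close>, as \<open>P\<close>
    is the derivation bracketing with \<open>h\<close> in the first slot.\<close>
  define Q :: "'f cochain" where "Q = (\<lambda>xs. if xs = [] then - h else 0)"
  have "Q \<in> multiderivations 0"
    by (auto simp: multiderivations_def Q_def smult3_def)
  moreover have "P = coboundary_op (jacobian_bracket \<phi>) 0 Q"
  proof
    fix xs
    show "P xs = coboundary_op (jacobian_bracket \<phi>) 0 Q xs"
    proof (cases "length xs = 1")
      case True
      then obtain f where "xs = [f]" by (auto simp: length_Suc_conv)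
      then show ?thesis
        by (simp add: coboundary_op_0 Q_def Pf h jacobian_bracket_pair pdiff_uminus algebra_simps)
    qed (simp add: multiderivationsD(1)[OF md] coboundary_op_length)
  qed
  ultimately show ?thesis by (auto simp: coboundaries_def)
qed

theorem proposition1p2:
  fixes \<phi> :: "'f::field_char_0 poly3" and w :: "3 \<Rightarrow> nat" and d :: nat
    and \<pi>\<^sub>0 :: "'f cochain"
  assumes "weight_homogeneous w d \<phi>"
    and "isolated_singularity \<phi>"
    and "poisson_structure \<pi>\<^sub>0"
    and "\<pi>\<^sub>0 [Var 0, Var 1] = pdiff 2 \<phi>"
    and "\<pi>\<^sub>0 [Var 1, Var 2] = pdiff 0 \<phi>"
    and "\<pi>\<^sub>0 [Var 2, Var 0] = pdiff 1 \<phi>"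
  shows "(\<exists>(K :: nat set) (\<theta> :: nat \<Rightarrow> 'f cochain)
            (\<Psi> :: (nat \<Rightarrow> nat \<Rightarrow> 'f) \<Rightarrow> nat \<Rightarrow> 'f cochain).
            cohomology_basis \<pi>\<^sub>0 2 K \<theta> \<and>
            (\<forall>a\<in>param_families K. \<forall>n\<ge>1. \<Psi> a n \<in> multiderivations 2) \<and>
            (\<forall>a\<in>param_families K. \<Psi> a 1 = 0) \<and>
            (\<forall>n\<ge>1. \<forall>a\<in>param_families K. \<forall>b\<in>param_families K.
               (\<forall>k\<in>K. \<forall>m\<in>{1..n - 1}. a m k = b m k) \<longrightarrow> \<Psi> a n = \<Psi> b n) \<and>
            (\<forall>a\<in>param_families K. formal_deformation \<pi>\<^sub>0
               (\<lambda>n. if n = 0 then \<pi>\<^sub>0 else \<Psi> a n + lincomb cscale K (a n) \<theta>)))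
       \<and> (d \<noteq> w 0 + w 1 + w 2 \<longrightarrow> poisson_cohomology \<pi>\<^sub>0 1 = {coboundaries \<pi>\<^sub>0 1})"
proof
  interpret isolated_quasihomogeneous w d \<phi>
    using assms(1,2) weight_homogeneous_imp_homogeneous
    by unfold_locales (auto simp: weight_homogeneous_def)
  have \<pi>: "\<pi>\<^sub>0 = jacobian_bracket \<phi>"
    using assms(3-6) biderivation_coordinates[of \<pi>\<^sub>0]
    by (simp add: poisson_structure_def bivector_jacobian)
  note subspace = coboundaries_subspace[OF jacobian_bracket_multiderivation[of \<phi>]]
  show "d \<noteq> w 0 + w 1 + w 2 \<longrightarrow> poisson_cohomology \<pi>\<^sub>0 1 = {coboundaries \<pi>\<^sub>0 1}"
  proof
    assume "d \<noteq> w 0 + w 1 + w 2"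
    then have "P +o coboundaries \<pi>\<^sub>0 1 = 0 +o coboundaries \<pi>\<^sub>0 1" if "P \<in> cocycles \<pi>\<^sub>0 1" for P
      using that cocycle_1_coboundary elt_set_plus_eq_iff[OF subspace cochain.module_axioms, where x = P and y = 0]
      by (simp add: \<pi>)
    moreover have "0 +o coboundaries \<pi>\<^sub>0 1 = coboundaries \<pi>\<^sub>0 1"
      by (simp add: elt_set_plus_def)
    moreover have "0 \<in> cocycles \<pi>\<^sub>0 1"
      using coboundary_op_add[OF jacobian_bracket_multiderivation[of \<phi>], of 1 0 0]
        cochain.subspace_0[OF multiderivations_subspace[of 1]]
      by (simp add: cocycles_def \<pi>)
    ultimately show "poisson_cohomology \<pi>\<^sub>0 1 = {coboundaries \<pi>\<^sub>0 1}"
      unfolding poisson_cohomology_def classes_def by (auto simp: image_iff)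
  qed

  \<comment> \<open>Monomials in either slot span all pairs and can be enumerated by
    \<open>nat\<close>. The pair \<open>(1, 0)\<close> gives the zero bivector, which the extraction
    of a basis discards.\<close>
  define T :: "('f poly3 \<times> 'f poly3) set" where
    "T = range (\<lambda>m. (Poly_Mapping.single m 1, 0)) \<union> range (\<lambda>m. (0, Poly_Mapping.single m 1))"
  have "countable T"
    unfolding T_def using countable_exponents by (intro countable_Un countable_image)
  moreover have "T \<noteq> {}" by (auto simp: T_def)
  moreover define e where "e = from_nat_into T"
  ultimately have e: "range e = T" by simp
  define \<theta> where "\<theta> n = special_bivector \<phi> (e n)" for n
  have "\<theta> n \<in> cocycles \<pi>\<^sub>0 2" for n
  proof -
    have "e n \<in> T" using e by blast
    then show ?thesis unfolding T_def \<theta>_def \<pi> using special_bivector_cocycle by auto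
  qed
  moreover have "cocycles \<pi>\<^sub>0 2 \<subseteq> cochain.span (range \<theta>)"
  proof
    fix P assume "P \<in> cocycles \<pi>\<^sub>0 2"
    then obtain h g where P: "P = special_bivector \<phi> (h, g)"
      unfolding \<pi> using cocycle_2_special by blast
    have range: "special_bivector \<phi> p \<in> range \<theta>" if "p \<in> T" for p
      using that unfolding e[symmetric] \<theta>_def by blast
    show "P \<in> cochain.span (range \<theta>)"
      unfolding P by (rule special_bivector_span; rule cochain.span_base; rule range) (simp_all add: T_def)
  qed
  ultimately obtain K where K: "cohomology_basis \<pi>\<^sub>0 2 K \<theta>"
    unfolding cohomology_basis_def
    using cochain.ex_classes_basis_subsequence[OF subspace[of 2], of \<theta> "cocycles \<pi>\<^sub>0 2"] \<pi> by auto
  define h g :: "(nat \<Rightarrow> nat \<Rightarrow> 'f) \<Rightarrow> nat \<Rightarrow> 'f poly3"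
    where "h a n = lincomb smult3 K (a n) (fst \<circ> e)" and "g a n = lincomb smult3 K (a n) (snd \<circ> e)" for a n
  \<comment> \<open>The end terms \<open>i = 0\<close> and \<open>i = n\<close> of the convolution
    form the part linear in the parameters of order \<open>n\<close>. Without them only orders up to
    \<open>n - 1\<close> occur, and the sum is empty for \<open>n = 1\<close>.\<close>
  define \<Psi> where "\<Psi> a n = bivector (\<Sum>i=1..n - 1. g a i * pdiff 0 (h a (n - i)))
     (\<Sum>i=1..n - 1. g a i * pdiff 1 (h a (n - i))) (\<Sum>i=1..n - 1. g a i * pdiff 2 (h a (n - i)))" for a n
  have lin: "lincomb cscale K (a n) \<theta> = special_bivector \<phi> (h a n, g a n)" for a n
    unfolding lincomb_def h_def g_def \<theta>_def special_bivector_sum by simp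
  have "\<Psi> a n = \<Psi> b n" if "\<forall>k\<in>K. \<forall>m\<in>{1..n - 1}. a m k = b m k" for a b n
  proof -
    have "h a i = h b i \<and> g a i = g b i" if "i \<in> {1..n - 1}" for i
      using that \<open>\<forall>k\<in>K. \<forall>m\<in>{1..n - 1}. a m k = b m k\<close>
      unfolding h_def g_def lincomb_def by (auto intro!: sum.cong)
    moreover have "n - i \<in> {1..n - 1}" if "i \<in> {1..n - 1}" for i
      using that by auto
    ultimately show ?thesis
      unfolding \<Psi>_def by (intro arg_cong3[where f = bivector] sum.cong) auto
  qed
  moreover have "formal_deformation \<pi>\<^sub>0 (\<lambda>n. if n = 0 then \<pi>\<^sub>0 else \<Psi> a n + lincomb cscale K (a n) \<theta>)" for a
  proof -
    \<comment> \<open>The constant terms \<open>1\<close> and \<phi> yield the given bracket at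
      order 0 and override \<open>g a 0\<close> and \<open>h a 0\<close>, which depend on the
      meaningless values \<open>a 0\<close>.\<close>
    let ?u = "\<lambda>n. if n = 0 then 1 else g a n" and ?\<chi> = "\<lambda>n. if n = 0 then \<phi> else h a n"
    have 0: "conformal_coeff ?u ?\<chi> 0 = \<pi>\<^sub>0"
      by (simp add: conformal_coeff_def \<pi> bivector_jacobian)
    have "conformal_coeff ?u ?\<chi> n = \<Psi> a n + lincomb cscale K (a n) \<theta>" if "n \<noteq> 0" for n
    proof -
      have "{..n} = insert 0 (insert n {1..n - 1})" using that by auto
      then have "(\<Sum>i\<le>n. ?u i * pdiff j (?\<chi> (n - i)))
        = (\<Sum>i=1..n - 1. g a i * pdiff j (h a (n - i))) + (pdiff j (h a n) + g a n * pdiff j \<phi>)" for j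
        using that by (simp cong: sum.cong_simp) (auto intro!: sum.cong)
      then show ?thesis
        unfolding conformal_coeff_def \<Psi>_def lin special_bivector_def by (simp add: bivector_add)
    qed
    then have "conformal_coeff ?u ?\<chi> = (\<lambda>n. if n = 0 then \<pi>\<^sub>0 else \<Psi> a n + lincomb cscale K (a n) \<theta>)"
      using 0 by auto
    then show ?thesis
      using conformal_formal_deformation[of ?u ?\<chi>] 0 by simp
  qed
  moreover have "\<Psi> a n \<in> multiderivations 2" "\<Psi> a 1 = 0" for a n
    by (simp_all add: \<Psi>_def bivector_multiderivation bivector_0)
  ultimately show "\<exists>(K :: nat set) (\<theta> :: nat \<Rightarrow> 'f cochain)
            (\<Psi> :: (nat \<Rightarrow> nat \<Rightarrow> 'f) \<Rightarrow> nat \<Rightarrow> 'f cochain).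
            cohomology_basis \<pi>\<^sub>0 2 K \<theta> \<and>
            (\<forall>a\<in>param_families K. \<forall>n\<ge>1. \<Psi> a n \<in> multiderivations 2) \<and>
            (\<forall>a\<in>param_families K. \<Psi> a 1 = 0) \<and>
            (\<forall>n\<ge>1. \<forall>a\<in>param_families K. \<forall>b\<in>param_families K.
               (\<forall>k\<in>K. \<forall>m\<in>{1..n - 1}. a m k = b m k) \<longrightarrow> \<Psi> a n = \<Psi> b n) \<and>
            (\<forall>a\<in>param_families K. formal_deformation \<pi>\<^sub>0
               (\<lambda>n. if n = 0 then \<pi>\<^sub>0 else \<Psi> a n + lincomb cscale K (a n) \<theta>))"
    using K by (intro exI[of _ K] exI[of _ \<theta>] exI[of _ \<Psi>]) blast
qed

end
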